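(* Let $(\mathcal A,\mathcal C_{\mathcal A})$ be a separable operator algebra with masa. Then $(\mathcal A,\mathcal C_{\mathcal A})$ is a regular limit of digraph algebras if and only if for each $\epsilon>0$ and each finite subset $\mathcal S\subseteq\mathcal A$ there exist a digraph algebra $(\mathcal B,\mathcal C_{\mathcal B})$ and a regular star extendible injection $\phi:\mathcal B\to\mathcal A$ with $\mathrm{dist}(\mathcal S,\phi(\mathcal B))<\epsilon$.
   Context: An operator algebra with masa $(\mathcal A,\mathcal C)$ is a norm closed subalgebra $\mathcal A$ of a $C^*$-algebra together with a maximal abelian self-adjoint subalgebra $\mathcal C$ of the generated $C^*$-algebra $C^*(\mathcal A)$ such that $\mathcal C\subseteq\mathcal A$. $N_{\mathcal C}(\mathcal A)$ is the set of partial isometries $v\in\mathcal A$ such that $v^*cv\in\mathcal C$ and $vcv^*\in\mathcal C$ for all $c\in\mathcal C$. A digraph algebra $(\mathcal B,\mathcal C_{\mathcal B})$ is a subalgebra $\mathcal B$ of some $M_n$ (complex matrices) spanned by the standard matrix units $e_{i,j}$ with $(i,j)$ in the edge set of a reflexive transitive digraph on $\{1,\dots,n\}$, with masa $\mathcal C_{\mathcal B}$ the diagonal matrices. An injection $\phi:\mathcal B\to\mathcal A$ is star extendible if it is the restriction of an injective $*$-homomorphism $C^*(\mathcal B)\to C^*(\mathcal A)$ (not necessarily unital), and an injection $(\mathcal B,\mathcal C_{\mathcal B})\to(\mathcal A,\mathcal C)$ is regular if $\phi(N_{\mathcal C_{\mathcal B}}(\mathcal B))\subseteq N_{\mathcal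 C}(\mathcal A)$. $(\mathcal A,\mathcal C)$ is a regular limit of digraph algebras if there are subalgebras with masas $(\mathcal A_1,\mathcal C_1)\subseteq(\mathcal A_2,\mathcal C_2)\subseteq\cdots$ of $(\mathcal A,\mathcal C)$ (that is, $\mathcal A_k\subseteq\mathcal A_{k+1}\subseteq\mathcal A$ and $\mathcal C_k\subseteq\mathcal C_{k+1}\subseteq\mathcal C$), each $(\mathcal A_k,\mathcal C_k)$ being the image of a digraph algebra and its masa under a star extendible injection, with $N_{\mathcal C_k}(\mathcal A_k)\subseteq N_{\mathcal C_{k+1}}(\mathcal A_{k+1})$ for all $k$, such that $\bigcup_k\mathcal A_k$ is norm dense in $\mathcal A$ and $\bigcup_k\mathcal C_k$ is norm dense in $\mathcal C$. $\mathrm{dist}(\mathcal S,X)<\epsilon$ means that every $s\in\mathcal S$ is at distance less than $\epsilon$ from $X$. *)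

theory Defs
  imports "HOL-Analysis.Analysis" "Jordan_Normal_Form.Schur_Decomposition"
begin

section \<open>C*-algebras\<close>

text \<open>Not necessarily unital. The real scalar multiplication required by the library's class of
  Banach algebras is the restriction of the complex one.\<close>

class c_star_algebra = real_normed_algebra + banach +
  fixes scaleC :: "complex \<Rightarrow> 'a \<Rightarrow> 'a"
    and adj :: "'a \<Rightarrow> 'a"
  assumes scaleC_add_right: "scaleC a (x + y) = scaleC a x + scaleC a y"
    and scaleC_add_left: "scaleC (a + b) x = scaleC a x + scaleC b x"
    and scaleC_scaleC: "scaleC a (scaleC b x) = scaleC (a * b) x"
    and scaleC_of_real: "scaleC (complex_of_real r) x = scaleR r x"
    and mult_scaleC_left: "scaleC a x * y = scaleC a (x * y)"
    and mult_scaleC_right: "x * scaleC a y = scaleC a (x * y)"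
    and norm_scaleC: "norm (scaleC a x) = cmod a * norm x"
    and adj_adj: "adj (adj x) = x"
    and adj_add: "adj (x + y) = adj x + adj y"
    and adj_scaleC: "adj (scaleC a x) = scaleC (cnj a) (adj x)"
    and adj_mult: "adj (x * y) = adj y * adj x"
    and c_star_identity: "norm (adj x * x) = (norm x)\<^sup>2"

definition complex_subalgebra :: "'a::c_star_algebra set \<Rightarrow> bool" where
  "complex_subalgebra S \<longleftrightarrow> 0 \<in> S \<and> (\<forall>x\<in>S. \<forall>y\<in>S. x + y \<in> S) \<and>
     (\<forall>a. \<forall>x\<in>S. scaleC a x \<in> S) \<and> (\<forall>x\<in>S. \<forall>y\<in>S. x * y \<in> S)"

definition star_subalgebra :: "'a::c_star_algebra set \<Rightarrow> bool" where
  "star_subalgebra S \<longleftrightarrow> complex_subalgebra S \<and> (\<forall>x\<in>S. adj x \<in> S)"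

definition abelian_set :: "'a::c_star_algebra set \<Rightarrow> bool" where
  "abelian_set S \<longleftrightarrow> (\<forall>x\<in>S. \<forall>y\<in>S. x * y = y * x)"

definition generated_c_star :: "'a::c_star_algebra set \<Rightarrow> 'a set" where
  "generated_c_star A = \<Inter>{S. A \<subseteq> S \<and> star_subalgebra S \<and> closed S}"

definition is_masa :: "'a::c_star_algebra set \<Rightarrow> 'a set \<Rightarrow> bool" where
  "is_masa D C \<longleftrightarrow> C \<subseteq> D \<and> star_subalgebra C \<and> abelian_set C \<and>
     (\<forall>C'. C \<subseteq> C' \<and> C' \<subseteq> D \<and> star_subalgebra C' \<and> abelian_set C' \<longrightarrow> C' = C)"

definition operator_algebra_with_masa :: "'a::c_star_algebra set \<Rightarrow> 'a set \<Rightarrow> bool" where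
  "operator_algebra_with_masa A C \<longleftrightarrow>
     complex_subalgebra A \<and> closed A \<and> is_masa (generated_c_star A) C \<and> C \<subseteq> A"

definition partial_isometry :: "'a::c_star_algebra \<Rightarrow> bool" where
  "partial_isometry v \<longleftrightarrow> v * adj v * v = v"

definition masa_normalizer :: "'a::c_star_algebra set \<Rightarrow> 'a set \<Rightarrow> 'a set" where
  "masa_normalizer A C = {v \<in> A. partial_isometry v \<and>
     (\<forall>c\<in>C. adj v * c * v \<in> C \<and> v * c * adj v \<in> C)}"

section \<open>Digraph algebras\<close>

text \<open>The vertex set is \<open>{..<n}\<close>, in accordance with the matrix indexing of the library.
  In the library, \<^const>\<open>preorder_on\<close> also says that the relation is contained in
  \<open>{..<n} \<times> {..<n}\<close>.\<close>

definition rt_digraph :: "nat \<Rightarrow> (nat \<times> nat) set \<Rightarrow> bool" where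
  "rt_digraph n E \<longleftrightarrow> 1 \<le> n \<and> preorder_on {..<n} E"

definition matrix_unit :: "nat \<Rightarrow> nat \<times> nat \<Rightarrow> complex mat" where
  "matrix_unit n e = mat n n (\<lambda>kl. if kl = e then 1 else 0)"

text \<open>The linear combinations of the matrix units indexed by \<open>E\<close>. The sum is taken entrywise,
  because matrices of a size that is not fixed by the type are not an additive monoid.\<close>

definition digraph_algebra :: "nat \<Rightarrow> (nat \<times> nat) set \<Rightarrow> complex mat set" where
  "digraph_algebra n E =
     {mat n n (\<lambda>kl. \<Sum>e\<in>E. a e * matrix_unit n e $$ kl) | a. True}"

definition diagonal_masa :: "nat \<Rightarrow> complex mat set" where
  "diagonal_masa n = {M \<in> carrier_mat n n. diagonal_mat M}"

definition mat_star_subalgebra :: "nat \<Rightarrow> complex mat set \<Rightarrow> bool" where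
  "mat_star_subalgebra n S \<longleftrightarrow> S \<subseteq> carrier_mat n n \<and> 0\<^sub>m n n \<in> S \<and>
     (\<forall>X\<in>S. \<forall>Y\<in>S. X + Y \<in> S) \<and> (\<forall>a. \<forall>X\<in>S. a \<cdot>\<^sub>m X \<in> S) \<and>
     (\<forall>X\<in>S. \<forall>Y\<in>S. X * Y \<in> S) \<and> (\<forall>X\<in>S. mat_adjoint X \<in> S)"

text \<open>The C*-algebra generated by a subset of \<open>M\<^sub>n\<close>. No closure is needed, since every linear
  subspace of \<open>M\<^sub>n\<close> is closed.\<close>

definition mat_generated_c_star :: "nat \<Rightarrow> complex mat set \<Rightarrow> complex mat set" where
  "mat_generated_c_star n B = \<Inter>{S. B \<subseteq> S \<and> mat_star_subalgebra n S}"

definition mat_masa_normalizer :: "complex mat set \<Rightarrow> complex mat set \<Rightarrow> complex mat set" where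
  "mat_masa_normalizer B C = {v \<in> B. v * mat_adjoint v * v = v \<and>
     (\<forall>c\<in>C. mat_adjoint v * c * v \<in> C \<and> v * c * mat_adjoint v \<in> C)}"

section \<open>Star extendible injections and regular limits\<close>

definition star_hom ::
    "complex mat set \<Rightarrow> 'a::c_star_algebra set \<Rightarrow> (complex mat \<Rightarrow> 'a) \<Rightarrow> bool" where
  "star_hom M D \<psi> \<longleftrightarrow> (\<forall>X\<in>M. \<psi> X \<in> D) \<and>
     (\<forall>X\<in>M. \<forall>Y\<in>M. \<psi> (X + Y) = \<psi> X + \<psi> Y) \<and>
     (\<forall>a. \<forall>X\<in>M. \<psi> (a \<cdot>\<^sub>m X) = scaleC a (\<psi> X)) \<and>
     (\<forall>X\<in>M. \<forall>Y\<in>M. \<psi> (X * Y) = \<psi> X * \<psi> Y) \<and>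
     (\<forall>X\<in>M. \<psi> (mat_adjoint X) = adj (\<psi> X))"

definition star_extendible_injection ::
    "nat \<Rightarrow> complex mat set \<Rightarrow> 'a::c_star_algebra set \<Rightarrow> (complex mat \<Rightarrow> 'a) \<Rightarrow> bool" where
  "star_extendible_injection n B A \<phi> \<longleftrightarrow> \<phi> ` B \<subseteq> A \<and>
     (\<exists>\<psi>. star_hom (mat_generated_c_star n B) (generated_c_star A) \<psi> \<and>
          inj_on \<psi> (mat_generated_c_star n B) \<and> (\<forall>b\<in>B. \<phi> b = \<psi> b))"

definition regular_map ::
    "complex mat set \<Rightarrow> complex mat set \<Rightarrow> 'a::c_star_algebra set \<Rightarrow> 'a set \<Rightarrow>
     (complex mat \<Rightarrow> 'a) \<Rightarrow> bool" where
  "regular_map B CB A C \<phi> \<longleftrightarrow> \<phi> ` mat_masa_normalizer B CB \<subseteq> masa_normalizer A C"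

definition regular_limit_of_digraph_algebras :: "'a::c_star_algebra set \<Rightarrow> 'a set \<Rightarrow> bool" where
  "regular_limit_of_digraph_algebras A C \<longleftrightarrow>
     (\<exists>(As :: nat \<Rightarrow> 'a set) (Cs :: nat \<Rightarrow> 'a set).
        (\<forall>k. operator_algebra_with_masa (As k) (Cs k) \<and>
             As k \<subseteq> As (Suc k) \<and> As k \<subseteq> A \<and> Cs k \<subseteq> Cs (Suc k) \<and> Cs k \<subseteq> C \<and>
             (\<exists>n E \<phi>. rt_digraph n E \<and> star_extendible_injection n (digraph_algebra n E) A \<phi> \<and>
                As k = \<phi> ` digraph_algebra n E \<and> Cs k = \<phi> ` diagonal_masa n) \<and>
             masa_normalizer (As k) (Cs k) \<subseteq> masa_normalizer (As (Suc k)) (Cs (Suc k))) \<and>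
        A \<subseteq> closure (\<Union>k. As k) \<and> C \<subseteq> closure (\<Union>k. Cs k))"

end

theory Submission
  imports Defs
begin

text \<open>
  A regular star extendible injection of a digraph algebra is the same thing as a system of matrix
  units \<open>F (i, j)\<close>, one for each pair of vertices in a common component of the digraph, that
  normalize the masa \<open>C\<close> and lie in \<open>A\<close> when \<open>(i, j)\<close> is an edge (\<open>regular_units\<close>). The harder
  direction is argued in terms of such systems.

  For a regular limit, an element \<open>v\<close> of \<open>As k\<close> that normalizes \<open>Cs k\<close> normalizes every later \<open>Cs j\<close>, hence
  the closure \<open>C\<close> of their union (\<open>chain_normalizer\<close>). The embeddings of the \<open>As k\<close> are therefore
  regular into \<open>A\<close>, and density of \<open>\<Union>k. As k\<close> gives the local approximation.

  Conversely, approximate a dense sequence of \<open>A\<close> by systems \<open>F\<^sub>1, F\<^sub>2, \<dots>\<close>. Consecutive systems are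
  not nested, and what has to be shown is that a system \<open>F\<close> whose units are approximated closely
  enough by the span of another system \<open>H\<close> is contained exactly in the span of a system near \<open>H\<close>.
  This rests on a rigidity of normalizers. A projection that normalizes \<open>C\<close> lies in \<open>C\<close>
  (\<open>normalizing_projection_in_masa\<close>), so the diagonal units do, and cutting a unit \<open>F (i, j)\<close> by
  diagonal units \<open>q\<^sub>k\<close>, \<open>q\<^sub>l\<close> of \<open>H\<close> leaves a partial isometry that normalizes \<open>C\<close>. Partial isometries
  have norm zero or one. Hence a corner \<open>q\<^sub>k F (i, j) q\<^sub>l\<close> that is close to zero is zero, and
  otherwise it equals \<open>u H (k, l)\<close> with \<open>u\<close> a unitary of \<open>q\<^sub>k D q\<^sub>k\<close>, where \<open>D\<close> is the C*-algebra
  generated by \<open>A\<close>, that is close to a scalar. Such a \<open>u\<close> moves every projection of \<open>C\<close> by less than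
  one and so commutes with it; since \<open>C\<close> is the closed span of its projections and maximal
  abelian, \<open>u\<close> lies in \<open>C\<close> (\<open>corner_phase\<close>).

  The units of \<open>F\<close> are thus sums of units of \<open>H\<close> up to phases from \<open>C\<close>. The phases are removed
  exactly, and not only approximately, by a change of \<open>H\<close>: in each component choose a root \<open>r\<close> and let
  \<open>w\<^sub>k\<close> be the phase at \<open>k\<close> of the unit \<open>F (i, r)\<close> to which \<open>q\<^sub>k\<close> belongs. Conjugation of \<open>H\<close> by
  \<open>W = \<Sum>k. w\<^sub>k\<close> gives a regular system that contains every \<open>F (i, r)\<close>, hence every
  \<open>F (i, j) = F (i, r) F (j, r)\<^sup>*\<close>. Since each \<open>w\<^sub>k\<close> is close to a scalar, this conjugation moves the
  span of \<open>H\<close> only a little (locale \<open>absorption\<close>), and the approximation survives. Iterating produces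
  the chain. Its masas are nested and its normalizers are nested because, for elements of
  the span, normalizing the diagonal is the same as normalizing \<open>C\<close> (\<open>masa_normalizer_span\<close>).
\<close>

section \<open>Elementary facts about C*-algebras\<close>

lemma scaleC_zero_left [simp]: "scaleC 0 (x::'a::c_star_algebra) = 0"
  using scaleC_of_real[of 0 x] by simp

lemma scaleC_one [simp]: "scaleC 1 (x::'a::c_star_algebra) = x"
  using scaleC_of_real[of 1 x] by simp

lemma scaleC_zero_right [simp]: "scaleC a (0::'a::c_star_algebra) = 0"
  using scaleC_scaleC[of a 0 "0::'a"] by simp

lemma scaleC_minus_right: "scaleC a (- x::'a::c_star_algebra) = - scaleC a x"
  using scaleC_add_right[of a x "- x"] by (simp add: eq_neg_iff_add_eq_0 add.commute)

lemma scaleC_minus_left: "scaleC (- a) (x::'a::c_star_algebra) = - scaleC a x"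
  using scaleC_add_left[of a "- a" x] by (simp add: eq_neg_iff_add_eq_0 add.commute)

lemma scaleC_diff_left: "scaleC (a - b) (x::'a::c_star_algebra) = scaleC a x - scaleC b x"
  using scaleC_add_left[of a "- b" x] by (simp add: scaleC_minus_left)

lemma scaleC_sum_right: "scaleC a (\<Sum>i\<in>I. f i :: 'a::c_star_algebra) = (\<Sum>i\<in>I. scaleC a (f i))"
  by (induction I rule: infinite_finite_induct) (auto simp: scaleC_add_right)

lemma scaleC_eq_0_iff [simp]: "scaleC a (x::'a::c_star_algebra) = 0 \<longleftrightarrow> a = 0 \<or> x = 0"
  using norm_scaleC[of a x] by (metis mult_eq_0_iff norm_eq_zero)

lemma adj_zero [simp]: "adj (0::'a::c_star_algebra) = 0"
  using adj_add[of "0::'a" 0] by simp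

lemma adj_minus: "adj (- x::'a::c_star_algebra) = - adj x"
  using adj_add[of x "- x"] by (simp add: eq_neg_iff_add_eq_0 add.commute)

lemma adj_diff: "adj (x - y::'a::c_star_algebra) = adj x - adj y"
  using adj_add[of x "- y"] by (simp add: adj_minus)

lemma adj_sum: "adj (\<Sum>i\<in>I. f i :: 'a::c_star_algebra) = (\<Sum>i\<in>I. adj (f i))"
  by (induction I rule: infinite_finite_induct) (auto simp: adj_add)

lemma norm_adj [simp]: "norm (adj (x::'a::c_star_algebra)) = norm x"
proof -
  have le: "norm y \<le> norm (adj y)" for y :: 'a
  proof (cases "y = 0")
    case False
    have "(norm y)\<^sup>2 \<le> norm (adj y) * norm y"
      using c_star_identity[of y] norm_mult_ineq[of "adj y" y] by simp
    then show ?thesis using False by (simp add: power2_eq_square)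
  qed simp
  show ?thesis using le[of x] le[of "adj x"] by (simp add: adj_adj)
qed

lemma c_star_identity': "norm (x * adj x) = (norm (x::'a::c_star_algebra))\<^sup>2"
  using c_star_identity[of "adj x"] by (simp add: adj_adj)

lemma bounded_linear_scaleC_left: "bounded_linear (\<lambda>a. scaleC a (x::'a::c_star_algebra))"
proof (rule bounded_linear_intro[where K = "norm x"])
  fix r a
  show "scaleC (r *\<^sub>R a) x = r *\<^sub>R scaleC a x"
    by (simp add: scaleC_of_real[symmetric] scaleC_scaleC scaleR_conv_of_real)
qed (auto simp: scaleC_add_left norm_scaleC)

lemma closed_complex_line: "closed (range (\<lambda>a. scaleC a (x::'a::c_star_algebra)))"
proof (cases "x = 0")
  case False
  have "complete (range (\<lambda>a. scaleC a x))"
    by (rule complete_isometric_image[OF _ subspace_UNIV bounded_linear_scaleC_left, of "norm x"])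
       (use False in \<open>auto simp: norm_scaleC complete_UNIV\<close>)
  then show ?thesis by (simp add: complete_eq_closed)
qed auto

lemma star_subalgebraD:
  assumes "star_subalgebra S"
  shows "0 \<in> S" "x \<in> S \<Longrightarrow> y \<in> S \<Longrightarrow> x + y \<in> S" "x \<in> S \<Longrightarrow> scaleC a x \<in> S"
    "x \<in> S \<Longrightarrow> y \<in> S \<Longrightarrow> x * y \<in> S" "x \<in> S \<Longrightarrow> adj x \<in> S"
    "x \<in> S \<Longrightarrow> - x \<in> S" "x \<in> S \<Longrightarrow> y \<in> S \<Longrightarrow> x - y \<in> S"
proof -
  show *: "0 \<in> S" "x \<in> S \<Longrightarrow> y \<in> S \<Longrightarrow> x + y \<in> S" "x \<in> S \<Longrightarrow> scaleC a x \<in> S"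
    "x \<in> S \<Longrightarrow> y \<in> S \<Longrightarrow> x * y \<in> S" "x \<in> S \<Longrightarrow> adj x \<in> S" for x y a
    using assms by (auto simp: star_subalgebra_def complex_subalgebra_def)
  show neg: "x \<in> S \<Longrightarrow> - x \<in> S" for x
    using *(3)[of x "-1"] by (simp add: scaleC_minus_left)
  show "x \<in> S \<Longrightarrow> y \<in> S \<Longrightarrow> x - y \<in> S"
    using *(2)[of x "- y"] neg by simp
qed

lemma complex_subalgebra_sum:
  assumes "complex_subalgebra S" "\<And>i. i \<in> I \<Longrightarrow> f i \<in> S"
  shows "sum f I \<in> S"
  using assms(2) by (induction I rule: infinite_finite_induct)
    (use assms(1) in \<open>auto simp: complex_subalgebra_def\<close>)

lemma star_subalgebra_sum:
  assumes "star_subalgebra S" "\<And>i. i \<in> I \<Longrightarrow> f i \<in> S"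
  shows "sum f I \<in> S"
  using assms complex_subalgebra_sum star_subalgebra_def by blast

section \<open>Projections and partial isometries\<close>

definition projection :: "'a::c_star_algebra \<Rightarrow> bool" where
  "projection p \<longleftrightarrow> adj p = p \<and> p * p = p"

text \<open>The C*-identity for \<open>v\<^sup>*v\<close>, which is its own square, reads \<open>t = t\<^sup>2\<close> for \<open>t = \<parallel>v\<^sup>*v\<parallel>\<close>.
  This gap between zero and one is what turns approximate statements into exact ones below.\<close>

lemma partial_isometry_norm:
  assumes "partial_isometry v"
  shows "v = 0 \<or> norm v = 1"
proof -
  define t where "t = norm (adj v * v)"
  have "t = norm ((adj v * v) * adj (adj v * v))"
    using assms by (simp add: t_def partial_isometry_def adj_mult adj_adj mult.assoc)
  also have "\<dots> = t\<^sup>2" unfolding t_def by (rule c_star_identity')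
  finally have "t = 0 \<or> t = 1" by (simp add: power2_eq_square)
  then have "norm v ^ 2 = 0 \<or> norm v ^ 2 = 1"
    by (simp add: t_def c_star_identity)
  then show ?thesis using norm_ge_zero[of v] by (auto simp: power2_eq_1_iff)
qed

lemma partial_isometry_eq_0:
  assumes "partial_isometry v" "norm v < 1"
  shows "v = 0"
  using partial_isometry_norm[OF assms(1)] assms(2) by auto

lemma projection_partial_isometry: "projection p \<Longrightarrow> partial_isometry p"
  by (simp add: projection_def partial_isometry_def)

lemma norm_projection_le: "projection p \<Longrightarrow> norm p \<le> 1"
  using partial_isometry_norm[OF projection_partial_isometry, of p] by auto

text \<open>The difference \<open>d\<close> of commuting projections satisfies \<open>d\<^sup>3 = d\<close>, so it is a partial
  isometry, and these have norm zero or one.\<close>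

lemma commuting_projections_eq:
  assumes p: "projection p" and q: "projection q" and comm: "p * q = q * p" and "norm (p - q) < 1"
  shows "p = q"
proof -
  have pp: "p * (p * x) = p * x" "q * (q * x) = q * x" "q * (p * x) = p * (q * x)" for x
    using p q comm by (simp_all add: projection_def mult.assoc[symmetric])
  have "partial_isometry (p - q)"
    using p q by (simp add: partial_isometry_def projection_def adj_diff algebra_simps pp comm[symmetric])
  then show ?thesis using partial_isometry_eq_0 assms(4) eq_iff_diff_eq_0 by blast
qed

section \<open>Sums of orthogonal elements\<close>

text \<open>The \<open>2\<^sup>m\<close>-th power of a sum of orthogonal self-adjoint elements is the sum of the powers,
  while by the C*-identity the norm of a self-adjoint element is multiplicative under squaring.\<close>

lemma norm_power_orthogonal_sum_le:
  fixes h :: "'i \<Rightarrow> 'a::c_star_algebra" and M :: real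
  assumes "finite I" "\<And>i. i \<in> I \<Longrightarrow> adj (h i) = h i"
    and "\<And>i j. i \<in> I \<Longrightarrow> j \<in> I \<Longrightarrow> i \<noteq> j \<Longrightarrow> h i * h j = 0"
    and "\<And>i. i \<in> I \<Longrightarrow> norm (h i) \<le> M"
  shows "norm (sum h I) ^ (2 ^ m) \<le> card I * M ^ (2 ^ m)"
  using assms(2-4)
proof (induction m arbitrary: h M)
  case 0
  then show ?case using sum_norm_bound[of I h M] by simp
next
  case (Suc m)
  have sq: "sum h I * sum h I = (\<Sum>i\<in>I. h i * h i)"
  proof -
    have "sum h I * sum h I = (\<Sum>i\<in>I. \<Sum>j\<in>I. if i = j then h i * h i else 0)"
      unfolding sum_product using Suc.prems(2) by (intro sum.cong) auto
    then show ?thesis using assms(1) by simp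
  qed
  have "adj (sum h I) = sum h I" using Suc.prems(1) by (simp add: adj_sum)
  then have n2: "(norm (sum h I))\<^sup>2 = norm (\<Sum>i\<in>I. h i * h i)"
    using c_star_identity[of "sum h I"] sq by simp
  have orth: "h i * h i * (h j * h j) = 0" if "i \<in> I" "j \<in> I" "i \<noteq> j" for i j
    using Suc.prems(2)[OF that] by (metis mult.assoc mult_zero_left mult_zero_right)
  have "norm (\<Sum>i\<in>I. h i * h i) ^ (2 ^ m) \<le> card I * (M\<^sup>2) ^ (2 ^ m)"
  proof (rule Suc.IH)
    fix i assume i: "i \<in> I"
    show "norm (h i * h i) \<le> M\<^sup>2"
      using norm_mult_ineq[of "h i" "h i"] mult_mono[OF Suc.prems(3)[OF i] Suc.prems(3)[OF i]]
        Suc.prems(3)[OF i] norm_ge_zero[of "h i"] by (simp add: power2_eq_square)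
  qed (use Suc.prems(1) orth in \<open>auto simp: adj_mult\<close>)
  then show ?case by (simp add: n2[symmetric] power_mult[symmetric])
qed

text \<open>The norm of a sum of orthogonal elements is at most the maximum of the norms: for \<open>h\<^sub>i =
  z\<^sub>i\<^sup>* z\<^sub>i\<close> the preceding bound, after taking \<open>2\<^sup>m\<close>-th roots, leaves only a root of the number
  of summands as a factor, and this tends to one. The number of summands must not enter, because
  the size of an approximating matrix algebra is not controlled by the accuracy.\<close>

lemma norm_orthogonal_sum_le:
  fixes z :: "'i \<Rightarrow> 'a::c_star_algebra"
  assumes fin: "finite I" and "0 \<le> M"
    and orth: "\<And>i j. i \<in> I \<Longrightarrow> j \<in> I \<Longrightarrow> i \<noteq> j \<Longrightarrow> adj (z i) * z j = 0"
    and orth': "\<And>i j. i \<in> I \<Longrightarrow> j \<in> I \<Longrightarrow> i \<noteq> j \<Longrightarrow> z i * adj (z j) = 0"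
    and le: "\<And>i. i \<in> I \<Longrightarrow> norm (z i) \<le> M"
  shows "norm (sum z I) \<le> M"
proof (rule ccontr)
  assume "\<not> norm (sum z I) \<le> M"
  define K where "K = (norm (sum z I))\<^sup>2"
  have KM: "M\<^sup>2 < K" using \<open>\<not> norm (sum z I) \<le> M\<close> \<open>0 \<le> M\<close>
    by (auto simp: K_def intro: power_strict_mono)
  have "adj (sum z I) * sum z I = (\<Sum>i\<in>I. \<Sum>j\<in>I. if i = j then adj (z i) * z i else 0)"
    unfolding adj_sum sum_product using orth by (intro sum.cong) auto
  then have K: "K = norm (\<Sum>i\<in>I. adj (z i) * z i)"
    using c_star_identity[of "sum z I"] fin by (simp add: K_def)
  have bound: "K ^ (2 ^ m) \<le> card I * (M\<^sup>2) ^ (2 ^ m)" for m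
    unfolding K
  proof (rule norm_power_orthogonal_sum_le[OF fin])
    fix i j assume ij: "i \<in> I" "j \<in> I" "i \<noteq> j"
    have "adj (z i) * z i * (adj (z j) * z j) = adj (z i) * (z i * adj (z j)) * z j"
      by (simp add: mult.assoc)
    then show "adj (z i) * z i * (adj (z j) * z j) = 0" using orth'[OF ij] by simp
  qed (auto simp: adj_mult adj_adj c_star_identity power_mono le)
  have "M\<^sup>2 > 0"
  proof (rule ccontr)
    assume "\<not> M\<^sup>2 > 0"
    then have "M\<^sup>2 = 0" using zero_le_power2[of M] by linarith
    then show False using bound[of 0] KM by simp
  qed
  then have ratio: "1 < K / M\<^sup>2" using KM by simp
  obtain N where N: "real (card I) < (K / M\<^sup>2) ^ N" using real_arch_pow[OF ratio] by blast
  also have "\<dots> \<le> (K / M\<^sup>2) ^ (2 ^ N)"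
    using ratio by (intro power_increasing) auto
  also have "\<dots> \<le> card I"
    using bound[of N] \<open>M\<^sup>2 > 0\<close> by (simp add: power_divide pos_divide_le_eq)
  finally show False by simp
qed

section \<open>Elements that normalize a masa\<close>

lemma generated_c_star_properties:
  fixes A :: "'a::c_star_algebra set"
  shows "star_subalgebra (generated_c_star A)" "closed (generated_c_star A)" "A \<subseteq> generated_c_star A"
  by (auto simp: generated_c_star_def star_subalgebra_def complex_subalgebra_def)

lemma generated_c_star_least:
  "A \<subseteq> S \<Longrightarrow> star_subalgebra S \<Longrightarrow> closed S \<Longrightarrow> generated_c_star A \<subseteq> S"
  by (auto simp: generated_c_star_def)

definition normalizes :: "'a::c_star_algebra set \<Rightarrow> 'a \<Rightarrow> bool" where
  "normalizes C v \<longleftrightarrow> (\<forall>c\<in>C. adj v * c * v \<in> C \<and> v * c * adj v \<in> C)"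

lemma normalizes_mult: "normalizes C v \<Longrightarrow> normalizes C w \<Longrightarrow> normalizes C (v * w)"
  unfolding normalizes_def adj_mult by (metis mult.assoc)

lemma normalizes_adj: "normalizes C v \<Longrightarrow> normalizes C (adj v)"
  by (simp add: normalizes_def adj_adj)

lemma masa_normalizer_iff:
  "v \<in> masa_normalizer A C \<longleftrightarrow> v \<in> A \<and> partial_isometry v \<and> normalizes C v"
  by (auto simp: masa_normalizer_def normalizes_def)

locale operator_masa =
  fixes A C :: "'a::c_star_algebra set"
  assumes masa: "operator_algebra_with_masa A C"
begin

abbreviation "D \<equiv> generated_c_star A"

lemma subalgebra_A: "complex_subalgebra A"
  and C_subset_A: "C \<subseteq> A"
  and star_C: "star_subalgebra C"
  and C_commute: "x \<in> C \<Longrightarrow> y \<in> C \<Longrightarrow> x * y = y * x"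
  using masa by (auto simp: operator_algebra_with_masa_def is_masa_def abelian_set_def)

lemma C_subset_D: "C \<subseteq> D" and A_subset_D: "A \<subseteq> D" and star_D: "star_subalgebra D"
  using generated_c_star_properties[of A] C_subset_A by auto

lemmas C_closure = star_subalgebraD[OF star_C]
lemmas D_closure = star_subalgebraD[OF star_D]

lemma masa_maximal:
  "C \<subseteq> C' \<Longrightarrow> C' \<subseteq> D \<Longrightarrow> star_subalgebra C' \<Longrightarrow> abelian_set C' \<Longrightarrow> C' = C"
  using masa unfolding operator_algebra_with_masa_def is_masa_def by blast

text \<open>The double commutant in \<open>D\<close> of a self-adjoint set \<open>S\<close> is a *-subalgebra. If \<open>S\<close> is
  commuting, then it lies in its own commutant, which makes the double commutant abelian; so
  maximality leaves no room outside \<open>C\<close>. The set is allowed to be larger than \<open>C\<close> in order that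
  the lemma applies to \<open>C\<close> together with new elements.\<close>

lemma commuting_family_in_masa:
  assumes CS: "C \<subseteq> S" and SD: "S \<subseteq> D"
    and adjS: "\<And>x. x \<in> S \<Longrightarrow> adj x \<in> S"
    and commS: "\<And>x y. x \<in> S \<Longrightarrow> y \<in> S \<Longrightarrow> x * y = y * x"
  shows "{x \<in> D. \<forall>y. (\<forall>s\<in>S. y * s = s * y) \<longrightarrow> x * y = y * x} = C"
    and "S \<subseteq> C"
proof -
  define S1 where "S1 = {y. \<forall>s\<in>S. y * s = s * y}"
  define S2 where "S2 = {x \<in> D. \<forall>y\<in>S1. x * y = y * x}"
  have adjS1: "adj y \<in> S1" if "y \<in> S1" for y
  proof -
    have "adj y * s = s * adj y" if "s \<in> S" for s
    proof -
      have "y * adj s = adj s * y" using \<open>y \<in> S1\<close> adjS[OF that] by (simp add: S1_def)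
      then have "adj (y * adj s) = adj (adj s * y)" by simp
      then show ?thesis by (simp add: adj_mult adj_adj)
    qed
    then show ?thesis by (simp add: S1_def)
  qed
  have "star_subalgebra S2"
    unfolding star_subalgebra_def complex_subalgebra_def
  proof (intro conjI ballI allI)
    fix x assume x: "x \<in> S2"
    have "adj x * y = y * adj x" if "y \<in> S1" for y
    proof -
      have "x * adj y = adj y * x" using x adjS1[OF that] by (simp add: S2_def)
      then have "adj (x * adj y) = adj (adj y * x)" by simp
      then show ?thesis by (simp add: adj_mult adj_adj)
    qed
    then show "adj x \<in> S2" using x by (simp add: S2_def D_closure)
    fix z assume z: "z \<in> S2"
    have "x * z * y = y * (x * z)" if "y \<in> S1" for y
      using x z that unfolding S2_def by (metis (mono_tags, lifting) mem_Collect_eq mult.assoc)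
    then show "x * z \<in> S2" using x z by (simp add: S2_def D_closure)
  qed (auto simp: S2_def D_closure distrib_left distrib_right mult_scaleC_left mult_scaleC_right)
  moreover have "S \<subseteq> S1" using commS unfolding S1_def by blast
  then have "abelian_set S2"
  proof -
    have "x \<in> S1" if "x \<in> S2" for x
      using that \<open>S \<subseteq> S1\<close> unfolding S2_def by (subst S1_def) blast
    then show ?thesis unfolding abelian_set_def S2_def by blast
  qed
  moreover have "S \<subseteq> S2"
  proof
    fix x assume "x \<in> S"
    then have "x * y = y * x" if "y \<in> S1" for y
      using that unfolding S1_def mem_Collect_eq by (metis (lifting))
    then show "x \<in> S2" using \<open>x \<in> S\<close> SD unfolding S2_def by blast
  qed
  then have "C \<subseteq> S2" using CS by blast
  moreover have "S2 \<subseteq> D" unfolding S2_def by blast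
  ultimately have "S2 = C" by (intro masa_maximal)
  then show "{x \<in> D. \<forall>y. (\<forall>s\<in>S. y * s = s * y) \<longrightarrow> x * y = y * x} = C"
    by (simp only: S2_def S1_def Ball_def mem_Collect_eq)
  show "S \<subseteq> C" using \<open>S2 = C\<close> \<open>S \<subseteq> S2\<close> by simp
qed

lemma normal_commuting_in_masa:
  assumes "u \<in> D" "u * adj u = adj u * u" and comm: "\<And>c. c \<in> C \<Longrightarrow> u * c = c * u"
  shows "u \<in> C"
proof -
  have comm': "adj u * c = c * adj u" if "c \<in> C" for c
  proof -
    have "adj (u * adj c) = adj (adj c * u)" using comm[of "adj c"] that by (simp add: C_closure)
    then show ?thesis by (simp add: adj_mult adj_adj)
  qed
  define S where "S = C \<union> {u, adj u}"
  have "x * y = y * x" if "x \<in> S" "y \<in> S" for x y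
    using that assms(2) comm comm' C_commute unfolding S_def
    by (metis Un_iff insertE singletonD)
  moreover have "adj x \<in> S" if "x \<in> S" for x
    using that by (auto simp: S_def C_closure adj_adj)
  moreover have "C \<subseteq> S" "S \<subseteq> D"
    using \<open>u \<in> D\<close> C_subset_D by (auto simp: S_def D_closure)
  ultimately have "S \<subseteq> C" by (intro commuting_family_in_masa(2))
  then show ?thesis by (simp add: S_def)
qed

text \<open>Maximality makes \<open>C\<close> its own double commutant in \<open>D\<close>, and commutants are closed.\<close>

lemma closed_C: "closed C"
proof -
  have *: "closed {x. x * y = y * x}" for y :: 'a
    by (intro closed_Collect_eq continuous_intros)
  have "closed (D \<inter> (\<Inter>y\<in>{y. \<forall>s\<in>C. y * s = s * y}. {x. x * y = y * x}))"
    by (intro closed_Int generated_c_star_properties(2) closed_INT ballI *)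
  also have "D \<inter> (\<Inter>y\<in>{y. \<forall>s\<in>C. y * s = s * y}. {x. x * y = y * x}) =
      {x \<in> D. \<forall>y. (\<forall>s\<in>C. y * s = s * y) \<longrightarrow> x * y = y * x}" by blast
  also have "\<dots> = C"
    using C_commute C_subset_D by (intro commuting_family_in_masa(1) order_refl C_closure)
  finally show ?thesis .
qed

text \<open>With a unit in \<open>C\<close> this is immediate, because then \<open>p = p1p\<close>. In general, fix a
  self-adjoint \<open>c\<close> and split it along \<open>p\<close>: let \<open>a = pcp\<close> and \<open>b = pc(1 - p)\<close>. Since \<open>a\<close> lies in
  \<open>C\<close>, it commutes with \<open>c\<close>, which says \<open>ab = 0\<close>. The same argument applied to \<open>c\<^sup>2\<close>, whose
  corner is \<open>a\<^sup>2 + bb\<^sup>*\<close>, gives \<open>bb\<^sup>*b = 0\<close>, hence \<open>b = 0\<close> and \<open>p\<close> commutes with \<open>c\<close>.\<close>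

lemma normalizing_projection_in_masa:
  assumes pD: "p \<in> D" and p: "projection p" and norm_p: "normalizes C p"
  shows "p \<in> C"
proof -
  have pp: "p * p = p" "p * (p * x) = p * x" and ap: "adj p = p" for x
    using p by (simp_all add: projection_def mult.assoc[symmetric])
  have key: "p * c * p * c' * p = p * c * p * c'" if "c \<in> C" "c' \<in> C" for c c'
  proof -
    have "p * c * p \<in> C" using norm_p that by (auto simp: normalizes_def ap)
    then have comm: "p * c * p * c' = c' * (p * c * p)" using C_commute that by blast
    then have "p * c * p * c' * p = c' * (p * c * p) * p" by simp
    also have "\<dots> = c' * (p * c * p)" by (simp add: mult.assoc pp)
    finally show ?thesis using comm by simp
  qed
  have sa: "p * c = c * p" if c: "c \<in> C" "adj c = c" for c
  proof -
    define b where "b = p * c - p * c * p"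
    have ab: "p * c * p * b = 0"
      using key[OF c(1) c(1)] by (simp add: b_def right_diff_distrib mult.assoc pp)
    have "p * (c * c) * p * b = 0"
      using key[of "c * c" c] c(1)
      by (simp add: b_def right_diff_distrib mult.assoc pp C_closure)
    moreover have adjb: "adj b = c * p - p * c * p"
      by (simp add: b_def adj_diff adj_mult ap c(2) mult.assoc)
    then have "p * (c * c) * p = p * c * p * (p * c * p) + b * adj b"
      by (simp only: adjb) (simp add: b_def algebra_simps pp)
    then have "p * (c * c) * p * b = p * c * p * (p * c * p * b) + b * adj b * b"
      by (simp add: distrib_right mult.assoc)
    ultimately have "b * adj b * b = 0" using ab by (simp add: mult.assoc)
    then have "norm (b * adj b * (b * adj b)) = 0" by (simp add: mult.assoc[symmetric])
    then have "norm (adj (b * adj b) * (b * adj b)) = 0" by (simp add: adj_mult adj_adj)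
    then have "norm (b * adj b) = 0" by (simp only: c_star_identity) simp
    then have "b = 0" by (simp only: c_star_identity') simp
    then have eq: "p * c = p * c * p" by (simp add: b_def)
    then have "adj (p * c) = adj (p * c * p)" by simp
    then show ?thesis using eq by (simp add: adj_mult ap c(2) mult.assoc)
  qed
  \<comment> \<open>The self-adjoint case applies to \<open>c + c\<^sup>*\<close> and \<open>\<i>(c - c\<^sup>*)\<close>.\<close>
  have "p * c = c * p" if "c \<in> C" for c
  proof -
    have "p * (c + adj c) = (c + adj c) * p"
      using that by (intro sa) (auto simp: C_closure adj_add adj_adj add.commute)
    moreover have "scaleC (- \<i>) (adj c - c) = scaleC \<i> (c - adj c)"
      by (metis minus_diff_eq minus_minus scaleC_minus_left scaleC_minus_right)
    then have "p * (scaleC \<i> (c - adj c)) = (scaleC \<i> (c - adj c)) * p"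
      using that by (intro sa) (auto simp: C_closure adj_scaleC adj_diff adj_adj)
    then have "scaleC (- \<i>) (p * (scaleC \<i> (c - adj c))) = scaleC (- \<i>) (scaleC \<i> (c - adj c) * p)"
      by simp
    then have "p * (c - adj c) = (c - adj c) * p"
      by (simp add: mult_scaleC_left mult_scaleC_right scaleC_scaleC)
    ultimately have "p * (c + adj c) + p * (c - adj c) = (c + adj c) * p + (c - adj c) * p" by simp
    then have "scaleR 2 (p * c) = scaleR 2 (c * p)" by (simp add: algebra_simps scaleR_2)
    then show ?thesis by simp
  qed
  then show ?thesis using pD by (intro normal_commuting_in_masa) (simp_all add: ap)
qed

end

section \<open>Systems of matrix units\<close>

definition lin_span :: "('i \<Rightarrow> 'a::c_star_algebra) \<Rightarrow> 'i set \<Rightarrow> 'a set" where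
  "lin_span F T = {\<Sum>e\<in>T. scaleC (a e) (F e) | a. True}"

lemma lin_spanI: "(\<Sum>e\<in>T. scaleC (a e) (F e)) \<in> lin_span F T"
  by (auto simp: lin_span_def)

lemma lin_span_add:
  assumes "x \<in> lin_span F T" "y \<in> lin_span F T"
  shows "x + y \<in> lin_span F T"
proof -
  obtain a b where "x = (\<Sum>e\<in>T. scaleC (a e) (F e))" "y = (\<Sum>e\<in>T. scaleC (b e) (F e))"
    using assms by (auto simp: lin_span_def)
  then have "x + y = (\<Sum>e\<in>T. scaleC (a e + b e) (F e))"
    by (simp add: scaleC_add_left sum.distrib)
  then show ?thesis by (auto simp: lin_span_def)
qed

lemma lin_span_scaleC:
  assumes "x \<in> lin_span F T"
  shows "scaleC c x \<in> lin_span F T"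
proof -
  obtain a where "x = (\<Sum>e\<in>T. scaleC (a e) (F e))"
    using assms by (auto simp: lin_span_def)
  then have "scaleC c x = (\<Sum>e\<in>T. scaleC (c * a e) (F e))"
    by (simp add: scaleC_sum_right scaleC_scaleC)
  then show ?thesis by (auto simp: lin_span_def)
qed

lemma lin_span_zero: "0 \<in> lin_span F T"
  using lin_spanI[of "\<lambda>_. 0" F T] by simp

lemma lin_span_sum: "(\<And>i. i \<in> I \<Longrightarrow> f i \<in> lin_span F T) \<Longrightarrow> sum f I \<in> lin_span F T"
  by (induction I rule: infinite_finite_induct) (auto simp: lin_span_zero lin_span_add)

lemma lin_span_base:
  assumes "finite T" "e \<in> T"
  shows "F e \<in> lin_span F T"
proof -
  have "(\<Sum>d\<in>T. scaleC (if d = e then 1 else 0) (F d)) = (\<Sum>d\<in>T. if d = e then F e else 0)"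
    by (intro sum.cong) auto
  then show ?thesis
    using assms lin_spanI[of "\<lambda>d. if d = e then 1 else 0" F T] by simp
qed

lemma lin_span_subset:
  assumes "complex_subalgebra S" "\<And>e. e \<in> T \<Longrightarrow> F e \<in> S"
  shows "lin_span F T \<subseteq> S"
  using assms by (auto simp: lin_span_def complex_subalgebra_def intro!: complex_subalgebra_sum[OF assms(1)])

lemma lin_span_mono:
  assumes "finite T" "T' \<subseteq> T"
  shows "lin_span F T' \<subseteq> lin_span F T"
proof
  fix x assume "x \<in> lin_span F T'"
  then obtain a where "x = (\<Sum>e\<in>T'. scaleC (a e) (F e))" by (auto simp: lin_span_def)
  then show "x \<in> lin_span F T"
    using assms by (auto intro!: lin_span_sum lin_span_scaleC lin_span_base)
qed

locale matrix_units =
  fixes n :: nat and R :: "(nat \<times> nat) set" and F :: "nat \<times> nat \<Rightarrow> 'a::c_star_algebra"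
  assumes equiv_R: "equiv {..<n} R"
    and F_mult: "\<And>i j k l. (i, j) \<in> R \<Longrightarrow> (k, l) \<in> R \<Longrightarrow>
      F (i, j) * F (k, l) = (if j = k then F (i, l) else 0)"
    and F_adj: "\<And>i j. (i, j) \<in> R \<Longrightarrow> adj (F (i, j)) = F (j, i)"
    and F_nonzero: "\<And>i. i < n \<Longrightarrow> F (i, i) \<noteq> 0"
begin

abbreviation "q i \<equiv> F (i, i)"

definition Q :: 'a where "Q = (\<Sum>i<n. q i)"

lemma R_bounds: "(i, j) \<in> R \<Longrightarrow> i < n \<and> j < n"
  and R_refl: "i < n \<Longrightarrow> (i, i) \<in> R"
  and R_sym: "(i, j) \<in> R \<Longrightarrow> (j, i) \<in> R"
  and R_trans: "(i, j) \<in> R \<Longrightarrow> (j, k) \<in> R \<Longrightarrow> (i, k) \<in> R"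
  using equiv_R unfolding equiv_def refl_on_def sym_def trans_def by blast+

lemma finite_R: "finite R"
  by (rule finite_subset[of _ "{..<n} \<times> {..<n}"]) (auto dest: R_bounds)

lemma finite_subset_R: "T \<subseteq> R \<Longrightarrow> finite T"
  using finite_R finite_subset by blast

lemma q_F: "k < n \<Longrightarrow> (i, j) \<in> R \<Longrightarrow> q k * F (i, j) = (if k = i then F (i, j) else 0)"
  and F_q: "k < n \<Longrightarrow> (i, j) \<in> R \<Longrightarrow> F (i, j) * q k = (if k = j then F (i, j) else 0)"
  and q_q: "k < n \<Longrightarrow> l < n \<Longrightarrow> q k * q l = (if k = l then q k else 0)"
  by (auto simp: F_mult R_refl)

lemma q_adj: "k < n \<Longrightarrow> adj (q k) = q k"
  by (simp add: F_adj R_refl)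

lemma q_projection: "k < n \<Longrightarrow> projection (q k)"
  by (simp add: projection_def q_adj q_q)

lemma F_partial_isometry: "(i, j) \<in> R \<Longrightarrow> partial_isometry (F (i, j))"
  using R_sym[of i j] R_bounds[of i j]
  by (simp add: partial_isometry_def F_adj F_mult R_refl)

lemma F_neq_0: "(i, j) \<in> R \<Longrightarrow> F (i, j) \<noteq> 0"
  using F_mult[of i j j i] F_nonzero[of i] R_bounds[of i j] R_sym[of i j] by auto

lemma norm_F: "(i, j) \<in> R \<Longrightarrow> norm (F (i, j)) = 1"
  using partial_isometry_norm F_partial_isometry F_neq_0 by blast

lemma Q_q: "k < n \<Longrightarrow> Q * q k = q k" and q_Q: "k < n \<Longrightarrow> q k * Q = q k"
  by (simp_all add: Q_def sum_distrib_left sum_distrib_right q_q)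

lemma Q_F: "(i, j) \<in> R \<Longrightarrow> Q * F (i, j) = F (i, j)" and F_Q: "(i, j) \<in> R \<Longrightarrow> F (i, j) * Q = F (i, j)"
  using R_bounds[of i j] by (simp_all add: Q_def sum_distrib_left sum_distrib_right q_F F_q)

lemma Q_projection: "projection Q"
proof -
  have "Q * (\<Sum>i<n. q i) = (\<Sum>i<n. q i)"
    unfolding sum_distrib_left by (intro sum.cong) (auto simp: Q_q)
  then have "Q * Q = Q" unfolding Q_def[symmetric] .
  moreover have "adj Q = Q" unfolding Q_def adj_sum by (intro sum.cong) (auto simp: q_adj)
  ultimately show ?thesis by (simp add: projection_def)
qed

lemma Q_Q: "Q * Q = Q" and Q_adj: "adj Q = Q"
  using Q_projection by (auto simp: projection_def)

lemma corner_F: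
  "k < n \<Longrightarrow> l < n \<Longrightarrow> e \<in> R \<Longrightarrow> q k * F e * q l = (if e = (k, l) then F e else 0)"
  using R_bounds[of "fst e" "snd e"] by (cases e) (auto simp: q_F F_q)

lemma corner_sum:
  assumes "T \<subseteq> R" "k < n" "l < n"
  shows "q k * (\<Sum>e\<in>T. scaleC (a e) (F e)) * q l =
    (if (k, l) \<in> T then scaleC (a (k, l)) (F (k, l)) else 0)"
proof -
  have "q k * (\<Sum>e\<in>T. scaleC (a e) (F e)) * q l =
      (\<Sum>e\<in>T. scaleC (a e) (q k * F e * q l))"
    by (simp add: sum_distrib_left sum_distrib_right mult_scaleC_left mult_scaleC_right)
  also have "\<dots> = (\<Sum>e\<in>T. if e = (k, l) then scaleC (a (k, l)) (F (k, l)) else 0)"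
    using assms corner_F by (intro sum.cong refl) (auto split: if_splits)
  finally show ?thesis using finite_subset_R[OF assms(1)] by simp
qed

lemma corner_decomposition: "Q * x * Q = (\<Sum>k<n. \<Sum>l<n. q k * x * q l)"
  unfolding Q_def by (simp add: sum_distrib_left sum_distrib_right) (rule sum.swap)

lemma Q_span: "T \<subseteq> R \<Longrightarrow> x \<in> lin_span F T \<Longrightarrow> Q * x = x \<and> x * Q = x"
  unfolding lin_span_def
  by (auto simp: sum_distrib_left sum_distrib_right mult_scaleC_left mult_scaleC_right Q_F F_Q subset_iff
      intro!: sum.cong)

text \<open>Membership in a span of matrix units is decided corner by corner. Every corner is a
  continuous function of \<open>x\<close> that has to lie in a closed line or vanish, so the span is closed;
  and the span of fewer units is recognized by the vanishing of the other corners.\<close>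

lemma lin_span_iff:
  assumes "T \<subseteq> R"
  shows "x \<in> lin_span F T \<longleftrightarrow> Q * x * Q = x \<and>
    (\<forall>k<n. \<forall>l<n. q k * x * q l \<in> (if (k, l) \<in> T then range (\<lambda>a. scaleC a (F (k, l))) else {0}))"
    (is "_ \<longleftrightarrow> ?r")
proof
  assume "x \<in> lin_span F T"
  then obtain a where "x = (\<Sum>e\<in>T. scaleC (a e) (F e))" by (auto simp: lin_span_def)
  moreover have "Q * x * Q = x" using Q_span[OF assms \<open>x \<in> lin_span F T\<close>] by simp
  ultimately show ?r using corner_sum[OF assms] by auto
next
  assume r: ?r
  have "q k * x * q l \<in> lin_span F T" if "k < n" "l < n" for k l
  proof -
    have "q k * x * q l \<in> (if (k, l) \<in> T then range (\<lambda>a. scaleC a (F (k, l))) else {0})"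
      using r that by blast
    moreover have "scaleC a (F (k, l)) \<in> lin_span F T" if "(k, l) \<in> T" for a
      by (intro lin_span_scaleC lin_span_base finite_subset_R assms that)
    ultimately show ?thesis by (auto simp: lin_span_zero split: if_splits)
  qed
  then have "Q * x * Q \<in> lin_span F T"
    unfolding corner_decomposition by (intro lin_span_sum) auto
  then show "x \<in> lin_span F T" using r by simp
qed

lemma closed_lin_span:
  assumes "T \<subseteq> R"
  shows "closed (lin_span F T)"
proof -
  have cl: "closed (if (k, l) \<in> T then range (\<lambda>a. scaleC a (F (k, l))) else {0})" for k l
    by (auto simp: closed_complex_line)
  have "closed {x. q k * x * q l \<in> (if (k, l) \<in> T then range (\<lambda>a. scaleC a (F (k, l))) else {0})}" for k l
    using continuous_closed_vimage[OF cl, of "\<lambda>x. q k * x * q l"]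
    by (simp add: vimage_def continuous_intros)
  then have "closed ({x. Q * x * Q = x} \<inter> (\<Inter>k\<in>{..<n}. \<Inter>l\<in>{..<n}.
      {x. q k * x * q l \<in> (if (k, l) \<in> T then range (\<lambda>a. scaleC a (F (k, l))) else {0})}))"
    by (intro closed_Int closed_INT ballI closed_Collect_eq continuous_intros)
  also have "\<dots> = lin_span F T"
    using lin_span_iff[OF assms] by auto
  finally show ?thesis .
qed

lemma complex_subalgebra_lin_span:
  assumes "T \<subseteq> R" "trans T"
  shows "complex_subalgebra (lin_span F T)"
  unfolding complex_subalgebra_def
proof (intro conjI ballI allI)
  fix x y assume "x \<in> lin_span F T" "y \<in> lin_span F T"
  then obtain a b where xy: "x = (\<Sum>e\<in>T. scaleC (a e) (F e))" "y = (\<Sum>e\<in>T. scaleC (b e) (F e))"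
    by (auto simp: lin_span_def)
  have *: "F e * F d \<in> lin_span F T" if "e \<in> T" "d \<in> T" for e d
  proof -
    obtain i j k l where ed: "e = (i, j)" "d = (k, l)" by (cases e, cases d)
    have "F e * F d = (if j = k then F (i, l) else 0)" using that assms(1) ed F_mult by (metis subsetD)
    moreover have "(i, l) \<in> T" if "j = k"
      using \<open>trans T\<close> \<open>e \<in> T\<close> \<open>d \<in> T\<close> that ed by (auto elim: transE)
    ultimately show ?thesis
      by (auto simp: lin_span_zero intro!: lin_span_base finite_subset_R assms)
  qed
  show "x * y \<in> lin_span F T"
    unfolding xy sum_product mult_scaleC_left mult_scaleC_right
    by (intro lin_span_sum lin_span_scaleC *)
qed (auto simp: lin_span_zero lin_span_add lin_span_scaleC)

lemma star_subalgebra_lin_span: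
  assumes "T \<subseteq> R" "trans T" "sym T"
  shows "star_subalgebra (lin_span F T)"
  unfolding star_subalgebra_def
proof (intro conjI ballI complex_subalgebra_lin_span assms)
  fix x assume "x \<in> lin_span F T"
  then obtain a where x: "x = (\<Sum>e\<in>T. scaleC (a e) (F e))" by (auto simp: lin_span_def)
  have "adj (F e) \<in> lin_span F T" if "e \<in> T" for e
  proof -
    obtain i j where e: "e = (i, j)" by (cases e)
    have "adj (F e) = F (j, i)" "(j, i) \<in> T"
      using that assms F_adj by (auto simp: e dest: symD)
    then show ?thesis using lin_span_base[OF finite_subset_R[OF assms(1)]] by simp
  qed
  then show "adj x \<in> lin_span F T"
    unfolding x by (auto simp: adj_sum adj_scaleC intro!: lin_span_sum lin_span_scaleC)
qed

lemma star_R: "star_subalgebra (lin_span F R)"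
  using equiv_R by (intro star_subalgebra_lin_span) (auto simp: equiv_def)

abbreviation "diagonal \<equiv> Id_on {..<n}"

lemma diagonal_subset_R: "diagonal \<subseteq> R" by (auto simp: R_refl)

lemma star_diagonal: "star_subalgebra (lin_span F diagonal)"
  by (intro star_subalgebra_lin_span diagonal_subset_R) (auto intro: transI symI)

lemma q_in_diagonal: "i < n \<Longrightarrow> q i \<in> lin_span F diagonal"
  by (rule lin_span_base) (auto simp: finite_subset_R diagonal_subset_R)

lemma commuting_with_q_diagonal:
  assumes x: "x \<in> lin_span F R" and comm: "\<And>i. i < n \<Longrightarrow> x * q i = q i * x"
  shows "x \<in> lin_span F diagonal"
proof -
  have "q k * x * q l = 0" if "k < n" "l < n" "k \<noteq> l" for k l
    using comm[of k] that by (metis mult.assoc mult_zero_right q_q)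
  then have "q k * x * q l \<in> (if (k, l) \<in> diagonal then range (\<lambda>a. scaleC a (F (k, l))) else {0})"
    if "k < n" "l < n" for k l
    using x that R_refl[of k] unfolding lin_span_iff[OF order_refl] by (cases "k = l") fastforce+
  then show ?thesis
    using x unfolding lin_span_iff[OF order_refl] lin_span_iff[OF diagonal_subset_R] by blast
qed

end

section \<open>Regular systems of matrix units\<close>

text \<open>The equivalence relation whose classes are the connected components, that is, the index
  set of the matrix units of the C*-algebra generated by the digraph algebra. Reflexivity on the
  vertices comes from \<open>E\<close>.\<close>

definition conn :: "(nat \<times> nat) set \<Rightarrow> (nat \<times> nat) set" where
  "conn E = (E \<union> E\<inverse>)\<^sup>+"

lemma subset_conn: "E \<subseteq> conn E"
  by (auto simp: conn_def)

lemma equiv_conn: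
  assumes "rt_digraph n E"
  shows "equiv {..<n} (conn E)"
proof -
  have E: "E \<subseteq> {..<n} \<times> {..<n}" "refl_on {..<n} E"
    using assms by (auto simp: rt_digraph_def preorder_on_def)
  have "conn E \<subseteq> {..<n} \<times> {..<n}"
    unfolding conn_def using E(1) by (intro trancl_subset_Sigma) auto
  moreover have "refl_on {..<n} (conn E)"
    using E(2) subset_conn[of E] by (auto simp: refl_on_def)
  moreover have "sym (conn E)"
    unfolding conn_def by (intro sym_trancl) (auto intro: symI)
  ultimately show ?thesis by (auto simp: equiv_def conn_def)
qed

lemma norm_corner_le:
  assumes "projection p" "projection q"
  shows "norm (p * x * q) \<le> norm x"
proof -
  have "norm (p * x * q) \<le> norm p * norm x * norm q"
    by (meson mult_right_mono norm_ge_zero norm_mult_ineq order_trans)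
  also have "\<dots> \<le> 1 * norm x * 1"
    using norm_projection_le[OF assms(1)] norm_projection_le[OF assms(2)]
    by (intro mult_mono) auto
  finally show ?thesis by simp
qed

lemma norm_cut_le:
  assumes "projection q"
  shows "norm (x - x * q) \<le> 2 * norm x"
proof -
  have "norm (x - x * q) \<le> norm x + norm x * norm q"
    by (meson add_left_mono norm_mult_ineq norm_triangle_ineq4 order_trans)
  also have "norm x * norm q \<le> norm x * 1"
    using norm_projection_le[OF assms] by (intro mult_left_mono) auto
  finally show ?thesis by simp
qed

context matrix_units
begin

lemma corner_near:
  assumes "T \<subseteq> R" "b \<in> lin_span F T" "norm (v - b) < \<delta>" "k < n" "l < n"
  obtains a where "norm (q k * v * q l - (if (k, l) \<in> T then scaleC a (F (k, l)) else 0)) < \<delta>"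
proof -
  obtain a where b: "b = (\<Sum>e\<in>T. scaleC (a e) (F e))" using assms(2) by (auto simp: lin_span_def)
  have "norm (q k * (v - b) * q l) < \<delta>"
    using norm_corner_le[OF q_projection q_projection, of k l "v - b"] assms by simp
  then have "norm (q k * v * q l - q k * b * q l) < \<delta>" by (simp add: algebra_simps)
  then show ?thesis using that[of "a (k, l)"] corner_sum[OF assms(1,4,5), of a] b by simp
qed

end

text \<open>The units of all edges of \<open>conn E\<close> lie in \<open>D\<close> and normalize \<open>C\<close>, because they are products
  of the units of edges of \<open>E\<close> and of their adjoints; it is enough to require this on \<open>E\<close>.\<close>

locale regular_units = operator_masa A C + matrix_units n "conn E" F
  for A C :: "'a::c_star_algebra set" and n E and F :: "nat \<times> nat \<Rightarrow> 'a" +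
  assumes digraph: "rt_digraph n E"
    and F_in_A: "\<And>e. e \<in> E \<Longrightarrow> F e \<in> A"
    and F_normalizes_base: "\<And>e. e \<in> E \<Longrightarrow> normalizes C (F e)"
begin

lemma E_trans: "trans E" and diagonal_subset_E: "diagonal \<subseteq> E"
  using digraph by (auto simp: rt_digraph_def preorder_on_def refl_on_def)

lemma finite_E: "finite E"
  using finite_subset_R subset_conn by blast

lemma F_in_D: "(i, j) \<in> conn E \<Longrightarrow> F (i, j) \<in> D"
  and F_normalizes: "(i, j) \<in> conn E \<Longrightarrow> normalizes C (F (i, j))"
proof -
  have base: "F (i, j) \<in> D \<and> normalizes C (F (i, j))" if "(i, j) \<in> E \<union> E\<inverse>" for i j
  proof (cases "(i, j) \<in> E")
    case True
    then show ?thesis using F_in_A A_subset_D F_normalizes_base by blast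
  next
    case False
    then have ji: "(j, i) \<in> E" using that by auto
    then have "F (i, j) = adj (F (j, i))" using F_adj[of j i] subset_conn by (metis subsetD)
    then show ?thesis
      using F_in_A[OF ji] A_subset_D F_normalizes_base[OF ji] D_closure(5) normalizes_adj by auto
  qed
  have "F (i, j) \<in> D \<and> normalizes C (F (i, j))" if "(i, j) \<in> conn E" for i j
    using that unfolding conn_def
  proof (induction rule: trancl_induct)
    case (base j)
    then show ?case using \<open>\<And>j i. (i, j) \<in> E \<union> E\<inverse> \<Longrightarrow> _\<close> by blast
  next
    case (step j k)
    have "(i, j) \<in> conn E" "(j, k) \<in> conn E" using step.hyps by (auto simp: conn_def)
    then have "F (i, k) = F (i, j) * F (j, k)" using F_mult[of i j j k] by simp
    then show ?case using step.IH base[OF step.hyps(2)] D_closure(4) normalizes_mult by metis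
  qed
  then show "(i, j) \<in> conn E \<Longrightarrow> F (i, j) \<in> D"
    and "(i, j) \<in> conn E \<Longrightarrow> normalizes C (F (i, j))" by auto
qed

lemma q_in_C: "i < n \<Longrightarrow> q i \<in> C"
  using normalizing_projection_in_masa q_projection F_in_D F_normalizes R_refl by blast

lemma Q_in_C: "Q \<in> C"
  unfolding Q_def by (intro star_subalgebra_sum[OF star_C]) (auto simp: q_in_C)

lemma masa_pinching:
  assumes "c \<in> C"
  shows "c * Q = (\<Sum>i<n. q i * c * q i)"
  unfolding Q_def sum_distrib_left
proof (intro sum.cong refl)
  fix i assume "i \<in> {..<n}"
  then have i: "i < n" by simp
  have "c * q i = c * q i * q i" using i by (simp add: mult.assoc q_q)
  then show "c * q i = q i * c * q i" using C_commute[OF assms q_in_C[OF i]] by simp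
qed

lemma diagonal_span_subset_C: "lin_span F diagonal \<subseteq> C"
  using star_C by (intro lin_span_subset) (auto simp: star_subalgebra_def q_in_C)

lemma span_E_subset_A: "lin_span F E \<subseteq> A"
  by (intro lin_span_subset subalgebra_A F_in_A)

lemma span_E_subset_span_R: "lin_span F E \<subseteq> lin_span F (conn E)"
  by (intro lin_span_mono finite_R subset_conn)

lemma diagonal_span_subset_E: "lin_span F diagonal \<subseteq> lin_span F E"
  by (intro lin_span_mono finite_E diagonal_subset_E)

lemma span_R_subset_D: "lin_span F (conn E) \<subseteq> D"
  using star_D F_in_D by (intro lin_span_subset) (auto simp: star_subalgebra_def)

lemma masa_element_diagonal:
  "x \<in> C \<Longrightarrow> x \<in> lin_span F (conn E) \<Longrightarrow> x \<in> lin_span F diagonal"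
  using commuting_with_q_diagonal C_commute q_in_C by blast

text \<open>For \<open>v\<close> in the span, \<open>q\<^sub>l v\<^sup>* q\<^sub>i v q\<^sub>l\<^sub>'\<close> is a matrix unit times the product of two
  entries of row \<open>i\<close>, one of them conjugated. It vanishes for \<open>l \<noteq> l'\<close> when \<open>v\<^sup>* q\<^sub>i v\<close> lies in
  \<open>C\<close>, since then the factors \<open>q\<^sub>l\<close> and \<open>q\<^sub>l\<^sub>'\<close> can be brought together.\<close>

lemma single_entry_in_row:
  assumes v: "v \<in> lin_span F (conn E)" and i: "i < n" and C: "adj v * q i * v \<in> C"
  obtains a l where "(i, l) \<in> conn E" "q i * v = scaleC a (F (i, l))"
proof -
  have row: "q i * v = (\<Sum>l<n. q i * v * q l)"
  proof -
    have "q i * v = q i * v * Q" using Q_span[OF order_refl v] by (simp add: mult.assoc)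
    then show ?thesis by (simp add: Q_def sum_distrib_left)
  qed
  have entry: "q i * v * q l \<in> (if (i, l) \<in> conn E then range (\<lambda>a. scaleC a (F (i, l))) else {0})"
    if "l < n" for l
    using v i that by (simp only: lin_span_iff[OF order_refl])
  show thesis
  proof (cases "\<exists>l<n. q i * v * q l \<noteq> 0")
    case False
    then have "q i * v = scaleC 0 (F (i, i))" using row by simp
    then show thesis using that R_refl[OF i] by blast
  next
    case True
    then obtain l where l: "l < n" "q i * v * q l \<noteq> 0" by blast
    then obtain a where il: "(i, l) \<in> conn E" and a: "q i * v * q l = scaleC a (F (i, l))"
      using entry[of l] by (auto split: if_splits)
    have "a \<noteq> 0" using a l by auto
    have zero: "q i * v * q l' = 0" if l': "l' < n" "l' \<noteq> l" for l'
    proof (rule ccontr)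
      assume "q i * v * q l' \<noteq> 0"
      then obtain b where il': "(i, l') \<in> conn E" and b: "q i * v * q l' = scaleC b (F (i, l'))"
        using entry[of l'] l' by (auto split: if_splits)
      have ne: "F (l, l') \<noteq> 0" and "b \<noteq> 0"
        using F_neq_0[of l l'] R_trans[OF R_sym[OF il] il'] b \<open>q i * v * q l' \<noteq> 0\<close> by auto
      have "adj (q i * v * q l) * (q i * v * q l') = q l * (adj v * q i * v) * q l'"
        using q_q[OF i i] q_adj i l by (simp add: adj_mult mult.assoc) (metis mult.assoc)
      also have "\<dots> = (adj v * q i * v) * (q l * q l')"
        using C_commute[OF q_in_C[OF l(1)] C] by (simp add: mult.assoc)
      also have "\<dots> = 0" using q_q[OF l(1) l'(1)] l'(2) by simp
      finally have "scaleC (cnj a * b) (F (l, l')) = 0"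
        using F_adj[OF il] F_mult[OF R_sym[OF il] il'] unfolding a b
        by (simp add: adj_scaleC mult_scaleC_left mult_scaleC_right scaleC_scaleC mult.commute
            del: scaleC_eq_0_iff)
      then show False using ne \<open>a \<noteq> 0\<close> \<open>b \<noteq> 0\<close> by auto
    qed
    have "q i * v = (\<Sum>l'<n. if l' = l then q i * v * q l else 0)"
      unfolding row[symmetric] using zero by (subst row) (intro sum.cong, auto)
    then have "q i * v = scaleC a (F (i, l))" using l(1) a by simp
    then show thesis using that il by blast
  qed
qed

text \<open>Here \<open>v\<^sup>*cv\<close> is the sum of the \<open>(q\<^sub>i v)\<^sup>* c (q\<^sub>i v)\<close>, and each \<open>q\<^sub>i v\<close> is a multiple of a
  single unit, which normalizes \<open>C\<close>. So normalizing the finitely many \<open>q\<^sub>i\<close> is enough.\<close>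

lemma span_normalizes:
  assumes v: "v \<in> lin_span F (conn E)"
    and C: "\<And>i. i < n \<Longrightarrow> adj v * q i * v \<in> C" "\<And>i. i < n \<Longrightarrow> v * q i * adj v \<in> C"
  shows "normalizes C v"
proof -
  have *: "adj v * c * v \<in> C"
    if c: "c \<in> C" and v: "v \<in> lin_span F (conn E)" and C: "\<And>i. i < n \<Longrightarrow> adj v * q i * v \<in> C" for c v
  proof -
    have Qv: "Q * v = v" using Q_span[OF order_refl v] by simp
    have adj_qv: "adj (q i * v) = adj v * q i" if "i < n" for i
      using that by (simp add: adj_mult q_adj)
    have "adj v * c * v = adj v * (c * Q) * v" using Qv by (simp add: mult.assoc)
    also have "\<dots> = (\<Sum>i<n. adj (q i * v) * c * (q i * v))"
      unfolding masa_pinching[OF c] sum_distrib_left sum_distrib_right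
      using adj_qv by (intro sum.cong) (auto simp: mult.assoc)
    finally have "adj v * c * v = (\<Sum>i<n. adj (q i * v) * c * (q i * v))" .
    moreover have "adj (q i * v) * c * (q i * v) \<in> C" if i: "i < n" for i
    proof -
      obtain a l where il: "(i, l) \<in> conn E" and a: "q i * v = scaleC a (F (i, l))"
        using single_entry_in_row[OF v i C[OF i]] .
      have "adj (F (i, l)) * c * F (i, l) \<in> C"
        using F_normalizes[OF il] c by (simp add: normalizes_def)
      then show ?thesis unfolding a
        by (simp add: adj_scaleC mult_scaleC_left mult_scaleC_right C_closure)
    qed
    ultimately show ?thesis by (simp only:) (intro star_subalgebra_sum[OF star_C], simp)
  qed
  have "adj v \<in> lin_span F (conn E)" using star_R v by (rule star_subalgebraD)
  then have "v * c * adj v \<in> C" if "c \<in> C" for c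
    using *[of c "adj v"] C(2) that by (simp add: adj_adj)
  then show ?thesis using *[OF _ v C(1)] by (simp add: normalizes_def)
qed

text \<open>Normalizing \<open>C\<close> and normalizing the diagonal are the same for elements of the span,
  because an element of \<open>C\<close> in the span commutes with the \<open>q\<^sub>i\<close> and is therefore diagonal.\<close>

lemma masa_normalizer_span:
  assumes v: "v \<in> lin_span F E"
  shows "v \<in> masa_normalizer (lin_span F E) (lin_span F diagonal) \<longleftrightarrow> v \<in> masa_normalizer A C"
proof -
  have vR: "v \<in> lin_span F (conn E)" using v span_E_subset_span_R by blast
  have "normalizes (lin_span F diagonal) v \<longleftrightarrow> normalizes C v"
  proof
    assume "normalizes (lin_span F diagonal) v"
    then show "normalizes C v"
      using diagonal_span_subset_C q_in_diagonal
      by (intro span_normalizes[OF vR]) (auto simp: normalizes_def)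
  next
    assume norm: "normalizes C v"
    show "normalizes (lin_span F diagonal) v"
      unfolding normalizes_def
    proof
      fix c assume c: "c \<in> lin_span F diagonal"
      then have cR: "c \<in> C" "c \<in> lin_span F (conn E)"
        using diagonal_span_subset_C diagonal_span_subset_E span_E_subset_span_R by auto
      show "adj v * c * v \<in> lin_span F diagonal \<and> v * c * adj v \<in> lin_span F diagonal"
        using norm cR vR by (auto simp: normalizes_def intro!: masa_element_diagonal star_subalgebraD[OF star_R])
    qed
  qed
  then show ?thesis using v span_E_subset_A by (auto simp: masa_normalizer_iff)
qed

text \<open>The C*-algebra generated by the span of \<open>E\<close> lies in the span of \<open>conn E\<close>, where the
  diagonal is its own commutant.\<close>

lemma operator_algebra_with_masa_span:
  "operator_algebra_with_masa (lin_span F E) (lin_span F diagonal)"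
proof -
  have gen: "generated_c_star (lin_span F E) \<subseteq> lin_span F (conn E)"
    by (intro generated_c_star_least span_E_subset_span_R star_R closed_lin_span order_refl)
  have "is_masa (generated_c_star (lin_span F E)) (lin_span F diagonal)"
    unfolding is_masa_def
  proof (intro conjI allI impI star_diagonal)
    show "lin_span F diagonal \<subseteq> generated_c_star (lin_span F E)"
      using diagonal_span_subset_E generated_c_star_properties(3) by blast
    show "abelian_set (lin_span F diagonal)"
      using diagonal_span_subset_C C_commute unfolding abelian_set_def by blast
    fix C' assume C': "lin_span F diagonal \<subseteq> C' \<and> C' \<subseteq> generated_c_star (lin_span F E) \<and>
      star_subalgebra C' \<and> abelian_set C'"
    have "x \<in> lin_span F diagonal" if "x \<in> C'" for x
    proof (rule commuting_with_q_diagonal)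
      show "x \<in> lin_span F (conn E)" using C' gen that by blast
      show "x * q i = q i * x" if "i < n" for i
        using C' q_in_diagonal[OF that] \<open>x \<in> C'\<close> unfolding abelian_set_def by blast
    qed
    then show "C' = lin_span F diagonal" using C' by blast
  qed
  then show ?thesis
    by (simp add: operator_algebra_with_masa_def complex_subalgebra_lin_span closed_lin_span
        subset_conn E_trans diagonal_span_subset_E)
qed

text \<open>The diagonal part \<open>d\<close> of \<open>b\<close> serves. Since \<open>c\<close> commutes with the \<open>q\<^sub>i\<close>, the difference \<open>cQ
  - d\<close> is the orthogonal sum of the \<open>q\<^sub>i (c - b) q\<^sub>i\<close>, while \<open>c - cQ\<close> is \<open>c - b\<close> cut by \<open>1 -
  Q\<close>.\<close>

lemma masa_near_diagonal:
  assumes c: "c \<in> C" and b: "b \<in> lin_span F (conn E)" and near: "norm (c - b) < \<delta>"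
  obtains d where "d \<in> lin_span F diagonal" "norm (c - d) < 3 * \<delta>"
proof -
  define z where "z i = q i * (c - b) * q i" for i
  define d where "d = (\<Sum>i<n. q i * b * q i)"
  have d: "d \<in> lin_span F diagonal"
    unfolding d_def
  proof (intro lin_span_sum)
    fix i assume "i \<in> {..<n}"
    then have i: "i < n" by simp
    then have "q i * b * q i \<in> range (\<lambda>a. scaleC a (q i))"
      using b R_refl[OF i] unfolding lin_span_iff[OF order_refl] by metis
    then show "q i * b * q i \<in> lin_span F diagonal"
      using q_in_diagonal[OF i] lin_span_scaleC by auto
  qed
  note cQ = masa_pinching[OF c]
  have "(c - b) - (c - b) * Q = c - c * Q"
    using Q_span[OF order_refl b] by (simp add: left_diff_distrib)
  moreover have "norm ((c - b) - (c - b) * Q) < 2 * \<delta>"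
    using norm_cut_le[OF Q_projection, of "c - b"] near by linarith
  ultimately have 1: "norm (c - c * Q) < 2 * \<delta>" by (simp only:)
  have orth: "adj (z i) * z j = 0" "z i * adj (z j) = 0" if "i < n" "j < n" "i \<noteq> j" for i j
  proof -
    have "adj (z i) * z j = q i * adj (c - b) * (q i * q j) * (c - b) * q j"
      "z i * adj (z j) = q i * (c - b) * (q i * q j) * adj (c - b) * q j"
      using that by (simp_all add: z_def adj_mult q_adj mult.assoc)
    then show "adj (z i) * z j = 0" "z i * adj (z j) = 0" using q_q that by simp_all
  qed
  have "norm (\<Sum>i<n. z i) \<le> \<delta>"
  proof (rule norm_orthogonal_sum_le)
    show "0 \<le> \<delta>" using near norm_ge_zero[of "c - b"] by linarith
    fix i assume i: "i \<in> {..<n}"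
    then show "norm (z i) \<le> \<delta>"
      using norm_corner_le[OF q_projection q_projection, of i i "c - b"] near by (simp add: z_def)
  qed (use orth in auto)
  moreover have "(\<Sum>i<n. z i) = c * Q - d"
    by (simp add: z_def d_def cQ algebra_simps sum_subtractf)
  ultimately have "norm (c * Q - d) \<le> \<delta>" by simp
  then have "norm (c - d) < 3 * \<delta>"
    using 1 norm_triangle_ineq[of "c - c * Q" "c * Q - d"] by simp
  then show thesis using that d by blast
qed

end

section \<open>Rigidity of normalizers near a matrix algebra\<close>

context operator_masa
begin

text \<open>The consequence of \<open>C\<close> being the closed span of its projections that is used to show that
  an element commutes with \<open>C\<close>.\<close>

definition projections_separate :: bool where
  "projections_separate \<longleftrightarrow>
     (\<forall>u. (\<forall>p\<in>C. projection p \<longrightarrow> u * p = p * u) \<longrightarrow> (\<forall>c\<in>C. u * c = c * u))"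

lemma projections_separateI:
  assumes dense: "\<And>c \<epsilon>. c \<in> C \<Longrightarrow> \<epsilon> > 0 \<Longrightarrow>
    \<exists>n E F. regular_units A C n E F \<and> (\<exists>b\<in>lin_span F (conn E). norm (c - b) < \<epsilon>)"
  shows projections_separate
  unfolding projections_separate_def
proof (intro allI impI ballI)
  fix u c assume u: "\<forall>p\<in>C. projection p \<longrightarrow> u * p = p * u" and c: "c \<in> C"
  have "c \<in> closure {x. u * x = x * u}"
    unfolding closure_approachable
  proof (intro allI impI)
    fix e :: real assume "e > 0"
    then obtain n E F b where units: "regular_units A C n E F"
      and b: "b \<in> lin_span F (conn E)" "norm (c - b) < e / 3"
      using dense[OF c, of "e / 3"] by auto
    interpret regular_units A C n E F by (rule units)
    obtain d where d: "d \<in> lin_span F diagonal" "norm (c - d) < e"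
      using masa_near_diagonal[OF c b] by auto
    obtain a where "d = (\<Sum>e\<in>diagonal. scaleC (a e) (F e))" using d(1) by (auto simp: lin_span_def)
    moreover have "u * F e = F e * u" if "e \<in> diagonal" for e
      using u that q_in_C q_projection by auto
    ultimately have "u * d = d * u"
      by (simp add: sum_distrib_left sum_distrib_right mult_scaleC_left mult_scaleC_right)
    then show "\<exists>y\<in>{x. u * x = x * u}. dist y c < e"
      using d(2) by (auto simp: dist_norm norm_minus_commute)
  qed
  moreover have "closed {x. u * x = x * u}"
    by (intro closed_Collect_eq continuous_intros)
  ultimately show "u * c = c * u" by simp
qed

text \<open>Being close to a scalar, \<open>u\<close> almost commutes with a projection \<open>p\<close> of \<open>C\<close>, so \<open>upu\<^sup>*\<close> is
  closer than one to \<open>pq\<close>. Because \<open>u\<close> normalizes \<open>C\<close>, both are projections of the abelian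
  algebra \<open>C\<close>, and hence equal. So \<open>u\<close> commutes with \<open>C\<close>.\<close>

lemma near_scalar_in_masa:
  assumes sep: projections_separate
    and u: "u \<in> D" "normalizes C u" "q \<in> C" "projection q" "u * adj u = q" "adj u * u = q"
    and near: "norm (u - scaleC b q) \<le> \<delta>" "\<delta> < 1 / 2"
  shows "u \<in> C"
proof -
  have qq: "q * q = q" and qa: "adj q = q" using u(4) by (auto simp: projection_def)
  have pi: "partial_isometry u"
  proof -
    have a: "adj (u - q * u) = adj u - adj u * q" by (simp add: adj_diff adj_mult qa)
    have "(u - q * u) * adj (u - q * u) = u * adj u - u * adj u * q - q * (u * adj u) + q * (u * adj u) * q"
      unfolding a by (simp add: algebra_simps)
    also have "\<dots> = 0" by (simp add: u(5) qq)
    finally have "u - q * u = 0" using c_star_identity'[of "u - q * u"] by simp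
    then show ?thesis by (simp add: partial_isometry_def u(5))
  qed
  have qu: "q * u = u" using pi by (simp add: partial_isometry_def u(5))
  have uq: "u * q = u" using pi u(6) by (simp add: partial_isometry_def mult.assoc)
  have nu: "norm u \<le> 1" using partial_isometry_norm[OF pi] by auto
  have "u * p = p * u" if p: "p \<in> C" "projection p" for p
  proof -
    have ppa: "p * p = p" "adj p = p" using p(2) by (auto simp: projection_def)
    have qp: "q * p = p * q" using C_commute[OF u(3) p(1)] .
    define p' where "p' = u * p * adj u"
    have p'C: "p' \<in> C" using u(2) p(1) by (simp add: p'_def normalizes_def)
    have p': "projection p'"
    proof -
      have "p' * p' = u * p * (adj u * u) * p * adj u" by (simp add: p'_def mult.assoc)
      also have "\<dots> = u * (p * q * p) * adj u" by (simp add: u(6) mult.assoc)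
      also have "\<dots> = u * (q * (p * p)) * adj u" unfolding qp[symmetric] by (simp add: mult.assoc)
      also have "\<dots> = p'" using uq by (simp add: ppa p'_def mult.assoc[symmetric])
      finally show ?thesis by (simp add: projection_def p'_def adj_mult adj_adj ppa mult.assoc)
    qed
    have pq: "projection (p * q)"
      using qp qq by (simp add: projection_def adj_mult qa ppa) (metis mult.assoc ppa(1))
    have "u * p - p * u = (u - scaleC b q) * p - p * (u - scaleC b q)"
      by (simp add: algebra_simps mult_scaleC_left mult_scaleC_right qp)
    also have "norm \<dots> \<le> norm ((u - scaleC b q) * p) + norm (p * (u - scaleC b q))"
      by (rule norm_triangle_ineq4)
    also have "\<dots> \<le> \<delta> * 1 + 1 * \<delta>"
      using near(1) norm_projection_le[OF p(2)] order_trans[OF norm_ge_zero near(1)]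
      by (intro add_mono order_trans[OF norm_mult_ineq] mult_mono) auto
    finally have small: "norm (u * p - p * u) < 1" using near(2) by simp
    have "p' - p * q = (u * p - p * u) * adj u"
      by (simp add: p'_def left_diff_distrib mult.assoc u(5))
    then have "norm (p' - p * q) \<le> norm (u * p - p * u) * 1"
      using norm_mult_ineq[of "u * p - p * u" "adj u"] mult_left_mono[OF nu, of "norm (u * p - p * u)"]
      by simp
    then have "norm (p' - p * q) < 1" using small by linarith
    then have "p' = p * q"
      by (rule commuting_projections_eq[OF p' pq C_commute[OF p'C C_closure(4)[OF p(1) u(3)]]])
    then have "p' * u = p * (q * u)" by (simp add: mult.assoc)
    moreover have "p' * u = u * p"
    proof -
      have "p' * u = u * (p * q)" by (simp add: p'_def mult.assoc u(6))
      also have "\<dots> = u * q * p" unfolding qp[symmetric] by (simp add: mult.assoc)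
      finally show ?thesis by (simp add: uq)
    qed
    ultimately show ?thesis using qu by simp
  qed
  then have "u * c = c * u" if "c \<in> C" for c
    using sep that unfolding projections_separate_def by blast
  moreover have "u * adj u = adj u * u" by (simp add: u(5,6))
  ultimately show ?thesis using u(1) by (intro normal_commuting_in_masa)
qed

end

context regular_units
begin

text \<open>Both \<open>vq\<^sub>lv\<^sup>*\<close> and \<open>v\<^sup>*v\<close> lie in \<open>C\<close> and so commute with the cutting projections.\<close>

lemma corner_partial_isometry:
  assumes v: "partial_isometry v" "normalizes C v" "adj v * v \<in> C" and k: "k < n" and l: "l < n"
  shows "partial_isometry (q k * v * q l)" "normalizes C (q k * v * q l)"
proof -
  have R: "adj (q k * v * q l) = q l * adj v * q k"
    using k l by (simp add: adj_mult q_adj mult.assoc)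
  have "v * q l * adj v \<in> C" using v(2) q_in_C[OF l] by (simp add: normalizes_def)
  then have c1: "q k * (v * q l * adj v) = v * q l * adj v * q k"
    using C_commute q_in_C[OF k] by blast
  have c2: "q l * (adj v * v) = adj v * v * q l"
    using C_commute v(3) q_in_C[OF l] by blast
  have "(q k * v * q l) * (q l * adj v * q k) * (q k * v * q l) =
      q k * v * (q l * q l) * adj v * (q k * q k) * v * q l"
    by (simp add: mult.assoc)
  also have "\<dots> = q k * (v * q l * adj v * q k) * v * q l"
    using q_q[OF k k] q_q[OF l l] by (simp add: mult.assoc)
  also have "\<dots> = q k * q k * v * (q l * (adj v * v)) * q l"
    unfolding c1[symmetric] by (simp add: mult.assoc)
  also have "\<dots> = q k * q k * (v * adj v * v) * (q l * q l)"
    unfolding c2 by (simp add: mult.assoc)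
  also have "\<dots> = q k * v * q l"
    using q_q[OF k k] q_q[OF l l] v(1) by (simp add: partial_isometry_def)
  finally show "partial_isometry (q k * v * q l)" unfolding partial_isometry_def R .
  show "normalizes C (q k * v * q l)"
    using F_normalizes R_refl k l v(2) by (intro normalizes_mult) auto
qed

text \<open>If the range projection of \<open>x\<close> fell short of \<open>q\<^sub>k\<close>, the defect \<open>r\<close> would kill \<open>x\<close> but not
  \<open>F (k, l)\<close>, which \<open>x\<close> resembles up to a scalar of modulus almost one.\<close>

lemma range_projection_full:
  assumes x: "partial_isometry x" "q k * x = x" "x \<noteq> 0" and kl: "(k, l) \<in> conn E"
    and near: "norm (x - scaleC b (F (k, l))) < \<delta>" "\<delta> \<le> 1 / 2"
  shows "x * adj x = q k"
proof -
  have k: "k < n" and lk: "(l, k) \<in> conn E" using R_bounds R_sym kl by auto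
  define r where "r = q k - x * adj x"
  have xx: "x * adj x * x = x" using x(1) by (simp add: partial_isometry_def)
  have xq: "adj x * q k = adj x"
    using arg_cong[OF x(2), of adj] k by (simp add: adj_mult q_adj)
  have ra: "adj r = r" using k by (simp add: r_def adj_diff adj_mult adj_adj q_adj)
  have rq: "r * q k = r" using k xq q_q[OF k k] by (simp add: r_def left_diff_distrib mult.assoc)
  have rx: "r * x = 0" using xx x(2) by (simp add: r_def left_diff_distrib)
  have rr: "r * r = r"
  proof -
    have "r * r = r * q k - r * x * adj x" by (simp add: r_def right_diff_distrib mult.assoc)
    then show ?thesis using rq rx by simp
  qed
  then have proj: "projection r" using ra by (simp add: projection_def)
  have "r = 0"
  proof (rule ccontr)
    assume "r \<noteq> 0"
    then have "norm r = 1" using partial_isometry_norm[OF projection_partial_isometry[OF proj]] by simp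
    have "r * F (k, l) * adj (r * F (k, l)) = r * (F (k, l) * F (l, k)) * r"
      using F_adj[OF kl] by (simp add: adj_mult ra mult.assoc)
    also have "\<dots> = r" using F_mult[OF kl lk] rq rr by simp
    finally have "norm (r * F (k, l)) ^ 2 = 1"
      using c_star_identity'[of "r * F (k, l)"] \<open>norm r = 1\<close> by simp
    then have 1: "norm (r * F (k, l)) = 1"
      using norm_ge_zero[of "r * F (k, l)"] by (auto simp: power2_eq_1_iff)
    have "r * (x - scaleC b (F (k, l))) = - scaleC b (r * F (k, l))"
      by (simp add: right_diff_distrib rx mult_scaleC_right)
    then have "cmod b = norm (r * (x - scaleC b (F (k, l))))"
      using 1 by (simp add: norm_scaleC)
    also have "\<dots> \<le> norm (x - scaleC b (F (k, l)))"
      using norm_mult_ineq[of r "x - scaleC b (F (k, l))"] \<open>norm r = 1\<close> by simp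
    finally have "cmod b < \<delta>" using near by simp
    moreover have "norm x \<le> norm (x - scaleC b (F (k, l))) + norm (scaleC b (F (k, l)))"
      using norm_triangle_ineq[of "x - scaleC b (F (k, l))" "scaleC b (F (k, l))"] by simp
    moreover have "norm x = 1" using partial_isometry_norm[OF x(1)] x(3) by simp
    ultimately show False using near norm_F[OF kl] by (simp add: norm_scaleC)
  qed
  then show ?thesis by (simp add: r_def)
qed

text \<open>The phase of \<open>x\<close> is \<open>u = x F (l, k)\<close>. The scalar \<open>\<mu>\<close> is \<open>b\<close> normalized to modulus one,
  which costs a second \<open>\<delta>\<close>.\<close>

lemma corner_phase:
  assumes sep: projections_separate
    and x: "x \<in> D" "partial_isometry x" "normalizes C x" "q k * x * q l = x" "x \<noteq> 0"
    and kl: "(k, l) \<in> conn E"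
    and near: "norm (x - scaleC b (F (k, l))) < \<delta>" "\<delta> < 1 / 2"
  obtains \<mu> where "x * F (l, k) \<in> C" "x * adj x = q k" "adj x * x = q l"
    "x * F (l, k) * adj (x * F (l, k)) = q k" "x * F (l, k) * F (k, l) = x"
    "x * F (l, k) * q k = x * F (l, k)"
    "cmod \<mu> = 1" "norm (x * F (l, k) - scaleC \<mu> (q k)) \<le> 2 * \<delta>"
proof -
  have k: "k < n" and l: "l < n" and lk: "(l, k) \<in> conn E" using R_bounds R_sym kl by auto
  have qx: "q k * x = x" and xq: "x * q l = x"
    using x(4) q_q[OF k k] q_q[OF l l] by (metis mult.assoc)+
  have xx: "x * adj x = q k"
    using range_projection_full[OF x(2) qx x(5) kl near(1)] near(2) by simp
  have xx': "adj x * x = q l"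
  proof -
    have "norm (adj x - scaleC (cnj b) (F (l, k))) = norm (adj (x - scaleC b (F (k, l))))"
      using F_adj[OF kl] by (simp add: adj_diff adj_scaleC)
    then have "norm (adj x - scaleC (cnj b) (F (l, k))) < \<delta>" using near by simp
    moreover have "q l * adj x = adj x" using arg_cong[OF xq, of adj] l by (simp add: adj_mult q_adj)
    moreover have "partial_isometry (adj x)"
      using arg_cong[OF x(2)[unfolded partial_isometry_def], of adj]
      by (simp add: partial_isometry_def adj_mult adj_adj mult.assoc)
    moreover have "adj x \<noteq> 0" using x(5) adj_adj[of x] by auto
    ultimately show ?thesis
      using range_projection_full[of "adj x" l k] lk near(2) by (simp add: adj_adj)
  qed
  define u where "u = x * F (l, k)"
  have ua: "adj u = F (k, l) * adj x" using F_adj[OF lk] by (simp add: u_def adj_mult)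
  have uu: "u * adj u = q k"
    using F_mult[OF lk kl] xq xx by (simp add: ua) (simp add: u_def mult.assoc[symmetric], simp add: mult.assoc)
  have uu': "adj u * u = q k"
    using F_mult[OF kl lk] F_mult[OF lk R_refl[OF k]] xx'
    by (simp add: ua) (metis u_def mult.assoc F_q[OF l kl])
  have uF: "u * F (k, l) = x" using F_mult[OF lk kl] xq by (simp add: u_def mult.assoc)
  have uq: "u * q k = u" using F_q[OF k lk] by (simp add: u_def mult.assoc)
  have "u - scaleC b (q k) = (x - scaleC b (F (k, l))) * F (l, k)"
    using F_mult[OF kl lk] by (simp add: u_def left_diff_distrib mult_scaleC_left)
  then have "norm (u - scaleC b (q k)) \<le> norm (x - scaleC b (F (k, l))) * norm (F (l, k))"
    by (simp add: norm_mult_ineq)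
  then have nb: "norm (u - scaleC b (q k)) < \<delta>" using near(1) norm_F[OF lk] by simp
  have uC: "u \<in> C"
  proof (rule near_scalar_in_masa[OF sep _ _ q_in_C[OF k] q_projection[OF k] uu uu' _ near(2)])
    show "u \<in> D" "normalizes C u"
      using x F_in_D[OF lk] F_normalizes[OF lk] by (auto simp: u_def D_closure normalizes_mult)
    show "norm (u - scaleC b (q k)) \<le> \<delta>" using nb by simp
  qed
  have "partial_isometry u" using uu uC C_commute[OF uC q_in_C[OF k]] uq by (simp add: partial_isometry_def)
  moreover have "u \<noteq> 0" using uF x(5) by auto
  ultimately have nu: "norm u = 1" using partial_isometry_norm by auto
  have nq: "norm (q k) = 1" using norm_F[OF R_refl[OF k]] .
  have "\<bar>norm u - norm (scaleC b (q k))\<bar> \<le> norm (u - scaleC b (q k))" by (rule norm_triangle_ineq3)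
  then have mod: "\<bar>1 - cmod b\<bar> < \<delta>" using nu nq nb by (simp add: norm_scaleC)
  then have "b \<noteq> 0" using near(2) by auto
  define \<mu> where "\<mu> = b / of_real (cmod b)"
  have lam: "cmod \<mu> = 1" using \<open>b \<noteq> 0\<close> by (simp add: \<mu>_def norm_divide)
  have "b - \<mu> = \<mu> * of_real (cmod b - 1)" using \<open>b \<noteq> 0\<close> by (simp add: \<mu>_def field_simps)
  then have "cmod (b - \<mu>) = \<bar>cmod b - 1\<bar>" using lam by (simp only: norm_mult norm_of_real mult_1)
  then have "norm (scaleC b (q k) - scaleC \<mu> (q k)) < \<delta>"
    using mod nq by (simp add: scaleC_diff_left[symmetric] norm_scaleC)
  then have "norm (u - scaleC \<mu> (q k)) \<le> 2 * \<delta>"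
    using nb norm_triangle_ineq[of "u - scaleC b (q k)" "scaleC b (q k) - scaleC \<mu> (q k)"] by simp
  then show thesis using that[of \<mu>] uC xx xx' uu uF uq lam by (simp add: u_def)
qed

text \<open>Conjugation by a unitary of the masa leaves the diagonal units and regularity unchanged.\<close>

context
  fixes w
  assumes w: "w \<in> C" "w * adj w = Q"
begin

definition twist :: "nat \<times> nat \<Rightarrow> 'a" where "twist e = w * F e * adj w"

lemma adj_w_w: "adj w * w = Q"
  using C_commute[OF w(1), of "adj w"] w by (simp add: C_closure)

lemma twist_q: "i < n \<Longrightarrow> twist (i, i) = q i"
  using C_commute[OF w(1) q_in_C] w(2) q_Q by (simp add: twist_def mult.assoc)

lemma twist_mult:
  assumes "x \<in> lin_span F (conn E)"
  shows "(w * x * adj w) * (w * y * adj w) = w * (x * y) * adj w"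
proof -
  have "(w * x * adj w) * (w * y * adj w) = w * (x * (adj w * w)) * y * adj w" by (simp add: mult.assoc)
  then show ?thesis using Q_span[OF order_refl assms] by (simp add: adj_w_w mult.assoc)
qed

lemma regular_units_twist: "regular_units A C n E twist"
proof unfold_locales
  show "equiv {..<n} (conn E)" by (rule equiv_R)
  show "twist (i, j) * twist (k, l) = (if j = k then twist (i, l) else 0)"
    if "(i, j) \<in> conn E" "(k, l) \<in> conn E" for i j k l
    using twist_mult[OF lin_span_base[OF finite_R that(1)], of "F (k, l)"] F_mult[OF that]
    by (simp add: twist_def)
  show "adj (twist (i, j)) = twist (j, i)" if "(i, j) \<in> conn E" for i j
    using F_adj[OF that] by (simp add: twist_def adj_mult adj_adj mult.assoc)
  show "twist (i, i) \<noteq> 0" if "i < n" for i using twist_q F_nonzero that by simp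
  show "rt_digraph n E" by (rule digraph)
  have wA: "w \<in> A" "adj w \<in> A" using w C_subset_A by (auto simp: C_closure)
  show "twist e \<in> A" if "e \<in> E" for e
    using wA F_in_A[OF that] subalgebra_A by (simp add: twist_def complex_subalgebra_def)
  have wn: "normalizes C w" using w(1) by (simp add: normalizes_def C_closure)
  show "normalizes C (twist e)" if "e \<in> E" for e
    unfolding twist_def using wn F_normalizes_base[OF that] by (intro normalizes_mult normalizes_adj)
qed

lemma lin_span_twist:
  assumes "x \<in> lin_span F T"
  shows "w * x * adj w \<in> lin_span twist T"
proof -
  obtain a where "x = (\<Sum>e\<in>T. scaleC (a e) (F e))" using assms by (auto simp: lin_span_def)
  then have "w * x * adj w = (\<Sum>e\<in>T. scaleC (a e) (twist e))"
    by (simp add: twist_def sum_distrib_left sum_distrib_right mult_scaleC_left mult_scaleC_right)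
  then show ?thesis by (simp add: lin_spanI)
qed

end

end

section \<open>Absorbing one system into a twist of another\<close>

text \<open>The constants are tied to the gap in the norms of partial isometries: an error below \<open>1 /
  2\<close> stays below one after cutting by \<open>1 - Q\<close> or forming a commutator, both of which at most
  double it.\<close>

locale absorption =
  U: regular_units A C n E F + V: regular_units A C m G H
  for A C :: "'a::c_star_algebra set" and n E F and m G H +
  fixes \<delta> :: real
  assumes delta: "\<delta> < 1 / 2"
    and sep: "U.projections_separate"
    and near_conn: "\<And>e. e \<in> conn E \<Longrightarrow> \<exists>b\<in>lin_span H (conn G). norm (F e - b) < \<delta>"
    and near_E: "\<And>e. e \<in> E \<Longrightarrow> \<exists>b\<in>lin_span H G. norm (F e - b) < \<delta>"
begin

text \<open>The least vertex of the component of \<open>i\<close>. All that matters is that one vertex is chosen in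
  each component.\<close>

definition root :: "nat \<Rightarrow> nat" where "root i = (LEAST j. (i, j) \<in> conn E)"

abbreviation "g i \<equiv> F (i, root i)"

lemma root_conn: "i < n \<Longrightarrow> (i, root i) \<in> conn E"
  unfolding root_def by (rule LeastI) (rule U.R_refl)

lemma root_eq: "(i, j) \<in> conn E \<Longrightarrow> root i = root j"
  unfolding root_def using U.R_sym U.R_trans by (intro arg_cong[of _ _ Least]) blast

lemma root_less: "i < n \<Longrightarrow> root i < n"
  using root_conn U.R_bounds by blast

lemma root_root: "i < n \<Longrightarrow> root (root i) = root i"
  using root_eq root_conn by metis

text \<open>A system that approximates \<open>q\<^sub>i\<close> must have \<open>q\<^sub>i\<close> below its unit \<open>Q\<close>: the part of \<open>q\<^sub>i\<close>
  outside \<open>Q\<close> is a projection of norm less than one.\<close>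

lemma U_q_below:
  assumes i: "i < n"
  shows "U.q i * V.Q = U.q i" "V.Q * U.q i = U.q i"
proof -
  obtain b where b: "b \<in> lin_span H (conn G)" "norm (U.q i - b) < \<delta>"
    using near_conn[OF U.R_refl[OF i]] by blast
  define r where "r = U.q i - U.q i * V.Q"
  have comm: "U.q i * V.Q = V.Q * U.q i" using U.C_commute U.q_in_C i V.Q_in_C by blast
  have "r = (U.q i - b) - (U.q i - b) * V.Q"
    using V.Q_span[OF order_refl b(1)] by (simp add: r_def left_diff_distrib)
  then have "norm r < 1" using norm_cut_le[OF V.Q_projection, of "U.q i - b"] b(2) delta by simp
  moreover have "projection r"
  proof -
    have pp: "U.q i * U.q i = U.q i" using U.q_q i by simp
    have "U.q i * V.Q * U.q i = U.q i * V.Q" unfolding comm by (simp add: pp mult.assoc)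
    then have "r * U.q i = r" by (simp add: r_def left_diff_distrib pp)
    moreover have "r * V.Q = 0" by (simp add: r_def left_diff_distrib mult.assoc V.Q_Q)
    ultimately have "r * (U.q i - U.q i * V.Q) = r"
      by (simp add: right_diff_distrib mult.assoc[symmetric])
    then have "r * r = r" by (simp only: r_def[symmetric])
    moreover have "adj r = r"
      unfolding r_def using comm i by (simp add: adj_diff adj_mult U.q_adj V.Q_adj)
    ultimately show ?thesis by (simp add: projection_def)
  qed
  ultimately have "r = 0" using partial_isometry_eq_0 projection_partial_isometry by blast
  then show "U.q i * V.Q = U.q i" "V.Q * U.q i = U.q i" using comm by (simp_all add: r_def)
qed

lemma F_below:
  assumes "(i, j) \<in> conn E"
  shows "V.Q * F (i, j) * V.Q = F (i, j)"
proof -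
  have ij: "i < n" "j < n" using U.R_bounds assms by auto
  have "V.Q * (U.q i * F (i, j) * U.q j) * V.Q = V.Q * U.q i * F (i, j) * (U.q j * V.Q)"
    by (simp only: mult.assoc)
  also have "\<dots> = U.q i * F (i, j) * U.q j" using U_q_below ij by simp
  finally show ?thesis using U.q_F[OF ij(1) assms] U.F_q[OF ij(2) assms] by simp
qed

lemma corner_isometry:
  assumes e: "(i, j) \<in> conn E" and k: "k < m" and l: "l < m"
  shows "partial_isometry (V.q k * F (i, j) * V.q l)" "normalizes C (V.q k * F (i, j) * V.q l)"
    "V.q k * F (i, j) * V.q l \<in> U.D"
proof -
  have "adj (F (i, j)) * F (i, j) \<in> C"
    using U.F_adj[OF e] U.F_mult[OF U.R_sym[OF e] e] U.q_in_C[of j] U.R_bounds[OF e] by simp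
  then show "partial_isometry (V.q k * F (i, j) * V.q l)" "normalizes C (V.q k * F (i, j) * V.q l)"
    using V.corner_partial_isometry U.F_partial_isometry[OF e] U.F_normalizes[OF e] k l by auto
  show "V.q k * F (i, j) * V.q l \<in> U.D"
    using U.F_in_D[OF e] V.q_in_C k l U.C_subset_D by (intro U.D_closure) auto
qed

text \<open>A corner of an old matrix unit has norm zero or one, so at a position where the
  approximating matrix vanishes it is zero. This is how membership in the digraph algebra of
  \<open>G\<close>, and not only in its C*-algebra, is inherited from the approximation.\<close>

lemma corner_zero:
  assumes e: "e \<in> conn E" and T: "T \<subseteq> conn G" and b: "b \<in> lin_span H T" "norm (F e - b) < \<delta>"
    and k: "k < m" and l: "l < m" and kl: "(k, l) \<notin> T"
  shows "V.q k * F e * V.q l = 0"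
proof -
  obtain i j where ij: "e = (i, j)" by (cases e)
  have "norm (V.q k * F e * V.q l) < \<delta>"
    using V.corner_near[OF T b k l] kl by auto
  then have "norm (V.q k * F e * V.q l) < 1" using delta by linarith
  then show ?thesis
    using partial_isometry_eq_0[OF corner_isometry(1)[OF _ k l]] e unfolding ij by blast
qed

text \<open>In the matrix of \<open>g i\<close> with respect to \<open>H\<close>, the entry at \<open>(k, l)\<close> is nonzero. For given
  \<open>k\<close> there is at most one such \<open>i\<close> and \<open>l\<close>, by \<open>linked_unique\<close> below.\<close>

definition linked :: "nat \<Rightarrow> nat \<Rightarrow> nat \<Rightarrow> bool" where
  "linked i k l \<longleftrightarrow> i < n \<and> k < m \<and> l < m \<and> V.q k * g i * V.q l \<noteq> 0"

lemma linked_conn: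
  assumes "linked i k l"
  shows "(k, l) \<in> conn G"
  using assms near_conn[OF root_conn[of i]] corner_zero[OF root_conn[of i] order_refl]
  unfolding linked_def by blast

lemma linked_phase:
  assumes P: "linked i k l"
  defines "x \<equiv> V.q k * g i * V.q l"
  obtains \<mu> where "x * H (l, k) \<in> C" "x * adj x = V.q k" "adj x * x = V.q l"
    "x * H (l, k) * adj (x * H (l, k)) = V.q k" "x * H (l, k) * H (k, l) = x"
    "x * H (l, k) * V.q k = x * H (l, k)"
    "cmod \<mu> = 1" "norm (x * H (l, k) - scaleC \<mu> (V.q k)) \<le> 2 * \<delta>"
proof -
  have i: "i < n" and k: "k < m" and l: "l < m" and x0: "x \<noteq> 0"
    using P by (auto simp: linked_def x_def)
  have kl: "(k, l) \<in> conn G" by (rule linked_conn[OF P])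
  obtain b where b: "b \<in> lin_span H (conn G)" "norm (g i - b) < \<delta>"
    using near_conn[OF root_conn[OF i]] by blast
  obtain a where a: "norm (x - scaleC a (H (k, l))) < \<delta>"
    using V.corner_near[OF order_refl b k l] kl by (auto simp: x_def)
  have x: "V.q k * x * V.q l = x"
    using V.q_q[OF k k] V.q_q[OF l l] unfolding x_def by (simp add: mult.assoc) (simp add: mult.assoc[symmetric])
  show thesis
    using V.corner_phase[OF sep corner_isometry(3)[OF root_conn[OF i] k l]
        corner_isometry(1)[OF root_conn[OF i] k l] corner_isometry(2)[OF root_conn[OF i] k l]
        x[unfolded x_def] x0[unfolded x_def] kl a[unfolded x_def] delta] that
    unfolding x_def by blast
qed

text \<open>If \<open>g i\<close> has an entry in row \<open>k\<close>, this entry is a unitary from \<open>q\<^sub>l\<close> to \<open>q\<^sub>k\<close> by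
  \<open>linked_phase\<close>, so \<open>q\<^sub>k\<close> lies entirely below the range projection of \<open>g i\<close>, and \<open>q\<^sub>l\<close> below
  its source projection.\<close>

lemma linked_source: "linked i k l \<Longrightarrow> U.q i * V.q k = V.q k"
proof -
  assume P: "linked i k l"
  define x where "x = V.q k * g i * V.q l"
  have i: "i < n" and k: "k < m" using P by (auto simp: linked_def)
  have "U.q i * x = x"
  proof -
    have "U.q i * x = V.q k * (U.q i * g i) * V.q l"
      using U.C_commute[OF U.q_in_C[OF i] V.q_in_C[OF k]] by (simp add: x_def mult.assoc[symmetric])
    then show ?thesis using U.q_F[OF i root_conn[OF i]] by (simp add: x_def)
  qed
  moreover have "x * adj x = V.q k" using linked_phase[OF P] unfolding x_def by blast
  ultimately show ?thesis by (metis mult.assoc)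
qed

lemma linked_target: "linked i k l \<Longrightarrow> V.q l * U.q (root i) = V.q l"
proof -
  assume P: "linked i k l"
  define x where "x = V.q k * g i * V.q l"
  have i: "i < n" and l: "l < m" using P by (auto simp: linked_def)
  have "x * U.q (root i) = x"
  proof -
    have "x * U.q (root i) = V.q k * (g i * U.q (root i)) * V.q l"
      using U.C_commute[OF U.q_in_C[OF root_less[OF i]] V.q_in_C[OF l]] by (simp add: x_def mult.assoc)
    then show ?thesis using U.F_q[OF root_less[OF i] root_conn[OF i]] by (simp add: x_def)
  qed
  moreover have "adj x * x = V.q l" using linked_phase[OF P] unfolding x_def by blast
  ultimately show ?thesis by (metis mult.assoc)
qed

lemma linked_unique:
  assumes P: "linked i k l" and P': "linked i' k l'"
  shows "i = i' \<and> l = l'"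
proof -
  have ik: "i < n" "i' < n" "k < m" and l: "l < m" "l' < m" using P P' by (auto simp: linked_def)
  have "i = i'"
  proof (rule ccontr)
    assume "i \<noteq> i'"
    have "V.q k = U.q i * (U.q i' * V.q k)" using linked_source P P' by simp
    also have "\<dots> = 0" using U.q_q[OF ik(1,2)] \<open>i \<noteq> i'\<close> by (simp add: mult.assoc[symmetric])
    finally show False using V.F_nonzero[OF ik(3)] by simp
  qed
  moreover have "l = l'"
  proof (rule ccontr)
    assume "l \<noteq> l'"
    define x x' where "x = V.q k * g i * V.q l" and "x' = V.q k * g i * V.q l'"
    have c: "adj (g i) * V.q k * g i \<in> C"
      using U.F_normalizes[OF root_conn[OF ik(1)]] V.q_in_C[OF ik(3)] by (simp add: normalizes_def)
    have qk: "V.q k * V.q k = V.q k" using V.q_q ik by simp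
    have "adj x * x' = V.q l * adj (g i) * (V.q k * V.q k) * g i * V.q l'"
      using ik l by (simp add: x_def x'_def adj_mult V.q_adj mult.assoc)
    also have "\<dots> = V.q l * (adj (g i) * V.q k * g i) * V.q l'" by (simp add: qk mult.assoc)
    also have "\<dots> = (adj (g i) * V.q k * g i) * (V.q l * V.q l')"
      using U.C_commute[OF V.q_in_C[OF l(1)] c] by (simp add: mult.assoc)
    also have "\<dots> = 0" using V.q_q l \<open>l \<noteq> l'\<close> by simp
    finally have "x * adj x * x' = 0" by (simp add: mult.assoc)
    moreover have "x * adj x = V.q k" using linked_phase[OF P] unfolding x_def by blast
    moreover have "V.q k * x' = x'" using qk by (simp add: x'_def mult.assoc[symmetric])
    ultimately show False using P' \<open>i = i'\<close> by (simp add: linked_def x'_def)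
  qed
  ultimately show ?thesis by simp
qed

text \<open>The last clause makes the definition independent of the choice of \<open>i\<close> and \<open>l\<close>; it is
  consistent since at most one pair is linked to \<open>k\<close>. If none is, then \<open>q\<^sub>k\<close> itself is a phase.\<close>

definition phase :: "nat \<Rightarrow> 'a \<Rightarrow> bool" where
  "phase k w \<longleftrightarrow> w \<in> C \<and> w * adj w = V.q k \<and> w * V.q k = w \<and>
     (\<exists>\<mu>. cmod \<mu> = 1 \<and> norm (w - scaleC \<mu> (V.q k)) \<le> 2 * \<delta>) \<and>
     (\<forall>i l. linked i k l \<longrightarrow> w * H (k, l) = V.q k * g i * V.q l)"

lemma delta_nonneg: "n > 0 \<Longrightarrow> 0 \<le> \<delta>"
  using near_conn[OF U.R_refl[of 0]] by (meson less_eq_real_def norm_ge_zero order_le_less_trans)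

lemma n_pos: "n > 0"
  using U.digraph by (simp add: rt_digraph_def)

lemma ex_phase:
  assumes k: "k < m"
  shows "\<exists>w. phase k w"
proof (cases "\<exists>i l. linked i k l")
  case True
  then obtain i l where P: "linked i k l" by blast
  define x where "x = V.q k * g i * V.q l"
  from linked_phase[OF P] obtain \<mu> where x:
    "x * H (l, k) \<in> C" "x * H (l, k) * adj (x * H (l, k)) = V.q k" "x * H (l, k) * H (k, l) = x"
    "x * H (l, k) * V.q k = x * H (l, k)"
    "cmod \<mu> = 1" "norm (x * H (l, k) - scaleC \<mu> (V.q k)) \<le> 2 * \<delta>"
    unfolding x_def by blast
  have "x * H (l, k) * H (k, l') = V.q k * g i' * V.q l'" if "linked i' k l'" for i' l'
    using linked_unique[OF P that] x(3) by (simp add: x_def)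
  then have "phase k (x * H (l, k))" using x unfolding phase_def by blast
  then show ?thesis by blast
next
  case False
  have "norm (V.q k - scaleC 1 (V.q k)) \<le> 2 * \<delta>" using delta_nonneg[OF n_pos] by simp
  then have "phase k (V.q k)"
    unfolding phase_def using False k V.q_in_C[OF k] V.q_adj[OF k] V.q_q[OF k k]
    by (intro conjI exI[of _ 1]) auto
  then show ?thesis by blast
qed

definition w :: "nat \<Rightarrow> 'a" where "w k = (SOME w. phase k w)"

lemma phase_w: "k < m \<Longrightarrow> phase k (w k)"
  unfolding w_def using ex_phase by (rule someI_ex)

lemma w_q: "k < m \<Longrightarrow> w k * V.q k = w k" "k < m \<Longrightarrow> V.q k * w k = w k"
  using phase_w[of k] U.C_commute[OF V.q_in_C[of k], of "w k"] by (auto simp: phase_def)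

lemma w_in_C: "k < m \<Longrightarrow> w k \<in> C" and w_adj_w: "k < m \<Longrightarrow> w k * adj (w k) = V.q k"
  using phase_w[of k] by (auto simp: phase_def)

definition W :: 'a where "W = (\<Sum>k<m. w k)"

lemma W_in_C: "W \<in> C"
  unfolding W_def using w_in_C by (intro star_subalgebra_sum[OF U.star_C]) auto

lemma W_q: "k < m \<Longrightarrow> W * V.q k = w k"
proof -
  assume k: "k < m"
  have "w j * V.q k = (if j = k then w k else 0)" if "j < m" for j
  proof -
    have "w j * V.q k = w j * (V.q j * V.q k)" using w_q(1)[OF that] by (simp add: mult.assoc[symmetric])
    then show ?thesis using V.q_q[OF that k] w_q(1)[OF k] by auto
  qed
  then show ?thesis using k by (simp add: W_def sum_distrib_right)
qed

lemma W_unitary: "W * adj W = V.Q"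
proof -
  have "W * V.Q = W" by (simp add: V.Q_def sum_distrib_left W_q) (simp add: W_def)
  have "W * adj W = W * V.Q * adj W" by (simp add: \<open>W * V.Q = W\<close>)
  also have "\<dots> = (\<Sum>k<m. W * V.q k * adj (W * V.q k))"
    unfolding V.Q_def sum_distrib_left sum_distrib_right
    using V.q_adj V.q_q by (intro sum.cong) (auto simp: adj_mult mult.assoc[symmetric], simp add: mult.assoc)
  also have "\<dots> = V.Q" by (simp add: W_q w_adj_w V.Q_def)
  finally show ?thesis .
qed

abbreviation "H' \<equiv> V.twist W"

lemma regular_units_H': "regular_units A C m G H'"
  by (rule V.regular_units_twist[OF W_in_C W_unitary])

text \<open>At a root the unit \<open>g r\<close> is the projection \<open>q\<^sub>r\<close>, whose entries have trivial phase.
  Therefore the twist of \<open>H (k, l)\<close> acquires only the phase at \<open>k\<close>, which is the one carried by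
  \<open>g i\<close>.\<close>

lemma linked_root:
  assumes P: "linked i k l"
  shows "w l = V.q l"
proof -
  have i: "i < n" and l: "l < m" using P by (auto simp: linked_def)
  have eq: "V.q l * g (root i) * V.q l = V.q l"
    using linked_target[OF P] V.q_q[OF l l] root_root[OF i] by simp
  then have "linked (root i) l l"
    using root_less[OF i] l V.F_nonzero by (simp add: linked_def)
  then have "w l * V.q l = V.q l * g (root i) * V.q l"
    using phase_w[OF l] unfolding phase_def by blast
  then have "w l * V.q l = V.q l" using eq by simp
  then show ?thesis using w_q(1)[OF l] by simp
qed

lemma linked_twist:
  assumes P: "linked i k l"
  shows "V.q k * g i * V.q l = H' (k, l)"
proof -
  have kl: "(k, l) \<in> conn G" and k: "k < m" and l: "l < m"
    using linked_conn[OF P] P by (auto simp: linked_def)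
  have "H' (k, l) = W * V.q k * H (k, l) * adj (W * V.q l)"
    using V.q_F[OF k kl] V.F_q[OF l kl] V.q_adj[OF l]
    by (simp add: V.twist_def[OF W_in_C W_unitary] adj_mult mult.assoc) (simp add: mult.assoc[symmetric])
  also have "\<dots> = w k * H (k, l)"
    using W_q k l linked_root[OF P] V.q_adj[OF l] V.F_q[OF l kl] by (simp add: mult.assoc)
  also have "\<dots> = V.q k * g i * V.q l" using phase_w[OF k] P by (simp add: phase_def)
  finally show ?thesis by simp
qed

interpretation V': regular_units A C m G H' by (rule regular_units_H')

lemma F_in_span_conn:
  assumes "e \<in> conn E"
  shows "F e \<in> lin_span H' (conn G)"
proof -
  have g: "g i \<in> lin_span H' (conn G)" if i: "i < n" for i
  proof -
    have "V.q k * g i * V.q l \<in> lin_span H' (conn G)" if "k < m" "l < m" for k l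
    proof (cases "V.q k * g i * V.q l = 0")
      case False
      then have P: "linked i k l" using i that by (simp add: linked_def)
      show ?thesis unfolding linked_twist[OF P] by (intro lin_span_base V.finite_R linked_conn[OF P])
    qed (simp add: lin_span_zero)
    then have "V.Q * g i * V.Q \<in> lin_span H' (conn G)"
      unfolding V.corner_decomposition by (intro lin_span_sum) auto
    then show ?thesis using F_below[OF root_conn[OF i]] by simp
  qed
  obtain i j where ij: "e = (i, j)" by (cases e)
  then have e: "(i, j) \<in> conn E" and i: "i < n" and j: "j < n" using assms U.R_bounds by auto
  have "F e = g i * adj (g j)"
    using root_eq[OF e] root_conn i j U.F_adj U.F_mult U.R_sym ij by (metis (full_types))
  then show ?thesis using g i j by (auto intro: star_subalgebraD[OF V'.star_R])
qed

lemma F_in_span: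
  assumes e: "e \<in> E"
  shows "F e \<in> lin_span H' G"
proof -
  obtain b where b: "b \<in> lin_span H G" "norm (F e - b) < \<delta>" using near_E[OF e] by blast
  have eR: "e \<in> conn E" using e subset_conn by auto
  have q: "V'.q k = V.q k" if "k < m" for k using V.twist_q[OF W_in_C W_unitary that] .
  have z: "V'.q k * F e * V'.q l = 0" if "k < m" "l < m" "(k, l) \<notin> G" for k l
    using corner_zero[OF eR subset_conn b that] q that by simp
  have R: "V'.Q * F e * V'.Q = F e"
    "\<forall>k<m. \<forall>l<m. V'.q k * F e * V'.q l \<in>
      (if (k, l) \<in> conn G then range (\<lambda>a. scaleC a (H' (k, l))) else {0})"
    using F_in_span_conn[OF eR] unfolding V'.lin_span_iff[OF order_refl] by auto
  show ?thesis
    unfolding V'.lin_span_iff[OF subset_conn]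
  proof (intro conjI allI impI R(1))
    fix k l assume kl: "k < m" "l < m"
    show "V'.q k * F e * V'.q l \<in> (if (k, l) \<in> G then range (\<lambda>a. scaleC a (H' (k, l))) else {0})"
    proof (cases "(k, l) \<in> G")
      case True
      then have "(k, l) \<in> conn G" using subset_conn[of G] by blast
      then show ?thesis using R(2) kl True by (metis (no_types, lifting))
    next
      case False
      then show ?thesis using z[OF kl] by simp
    qed
  qed
qed

text \<open>Since \<open>W\<close> is close to a diagonal unitary \<open>L\<close> with scalar entries, and \<open>L\<^sup>*bL\<close> lies in the
  span of \<open>H\<close> together with \<open>b\<close>, the twist of \<open>L\<^sup>*bL\<close> is close to \<open>L(L\<^sup>*bL)L\<^sup>* = b\<close>.\<close>

lemma span_near_twist:
  assumes b: "b \<in> lin_span H G"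
  obtains b' where "b' \<in> lin_span H' G" "norm (b' - b) \<le> 4 * \<delta> * norm b"
proof -
  obtain \<mu> where mu: "\<And>k. k < m \<Longrightarrow> cmod (\<mu> k) = 1"
    "\<And>k. k < m \<Longrightarrow> norm (w k - scaleC (\<mu> k) (V.q k)) \<le> 2 * \<delta>"
    using phase_w unfolding phase_def by metis
  define L where "L = (\<Sum>k<m. scaleC (\<mu> k) (V.q k))"
  have L: "L \<in> lin_span H V.diagonal"
    unfolding L_def by (intro lin_span_sum lin_span_scaleC V.q_in_diagonal) auto
  have Lq: "L * V.q k = scaleC (\<mu> k) (V.q k)" if "k < m" for k
  proof -
    have "L * V.q k = (\<Sum>j<m. if j = k then scaleC (\<mu> k) (V.q k) else 0)"
      unfolding L_def sum_distrib_right
      using that V.q_q by (intro sum.cong) (auto simp: mult_scaleC_left)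
    then show ?thesis using that by simp
  qed
  have LL: "L * adj L = V.Q"
  proof -
    have "L * adj L = (\<Sum>k<m. scaleC (cnj (\<mu> k)) (L * V.q k))"
      by (simp add: L_def adj_sum adj_scaleC V.q_adj sum_distrib_left mult_scaleC_right)
    also have "\<dots> = V.Q"
      unfolding V.Q_def
    proof (intro sum.cong refl)
      fix k assume "k \<in> {..<m}"
      then have k: "k < m" by simp
      have "cnj (\<mu> k) * \<mu> k = 1"
        using mu(1)[OF k] complex_norm_square[of "\<mu> k"] by (simp add: mult.commute)
      then show "scaleC (cnj (\<mu> k)) (L * V.q k) = V.q k" by (simp add: Lq[OF k] scaleC_scaleC)
    qed
    finally show ?thesis .
  qed
  have nle: "norm y \<le> 1" if "y * adj y = V.Q" for y
  proof -
    have "(norm y)\<^sup>2 \<le> 1" using c_star_identity'[of y] that norm_projection_le[OF V.Q_projection] by simp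
    then show ?thesis by (simp add: abs_square_le_1)
  qed
  have nW: "norm W \<le> 1" and nL: "norm L \<le> 1" using nle W_unitary LL by auto
  define z where "z k = w k - scaleC (\<mu> k) (V.q k)" for k
  have zq: "z k = z k * V.q k" "z k = V.q k * z k" if "k < m" for k
    using w_q[OF that] V.q_q[OF that that]
    by (simp_all add: z_def left_diff_distrib right_diff_distrib mult_scaleC_left mult_scaleC_right)
  have orth: "adj (z i) * z j = 0" "z i * adj (z j) = 0" if "i < m" "j < m" "i \<noteq> j" for i j
  proof -
    have "adj (z i) * z j = adj (V.q i * z i) * (V.q j * z j)"
      "z i * adj (z j) = (z i * V.q i) * adj (z j * V.q j)"
      using zq[OF that(1)] zq[OF that(2)] by simp_all
    then have "adj (z i) * z j = adj (z i) * (V.q i * V.q j) * z j"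
      "z i * adj (z j) = z i * (V.q i * V.q j) * adj (z j)"
      using V.q_adj that by (simp_all add: adj_mult mult.assoc)
    then show "adj (z i) * z j = 0" "z i * adj (z j) = 0" using V.q_q that by simp_all
  qed
  have "norm (\<Sum>k<m. z k) \<le> 2 * \<delta>"
    by (rule norm_orthogonal_sum_le) (use orth mu(2) delta_nonneg[OF n_pos] in \<open>auto simp: z_def\<close>)
  then have WL: "norm (W - L) \<le> 2 * \<delta>" by (simp add: z_def W_def L_def sum_subtractf)
  define b0 where "b0 = adj L * b * L"
  have b0: "b0 \<in> lin_span H G"
  proof -
    have "L \<in> lin_span H G" "adj L \<in> lin_span H G"
      using L V.diagonal_span_subset_E star_subalgebraD(5)[OF V.star_diagonal L] by auto
    then show ?thesis
      using b V.complex_subalgebra_lin_span[OF subset_conn V.E_trans]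
      by (simp add: b0_def complex_subalgebra_def)
  qed
  have nb0: "norm b0 \<le> norm b"
  proof -
    have "norm b0 \<le> norm (adj L) * norm b * norm L"
      unfolding b0_def by (meson mult_right_mono norm_ge_zero norm_mult_ineq order_trans)
    also have "\<dots> \<le> 1 * norm b * 1" using nL by (intro mult_mono) auto
    finally show ?thesis by simp
  qed
  have Lb: "L * b0 * adj L = b"
  proof -
    have "L * b0 * adj L = (L * adj L) * b * (L * adj L)" by (simp add: b0_def mult.assoc)
    then show ?thesis
      using V.Q_span[OF order_refl] b V.span_E_subset_span_R by (auto simp: LL)
  qed
  have "W * b0 * adj W - b = (W - L) * b0 * adj W + L * b0 * adj (W - L)"
    by (subst Lb[symmetric]) (simp add: algebra_simps adj_diff)
  also have "norm \<dots> \<le> norm ((W - L) * b0 * adj W) + norm (L * b0 * adj (W - L))"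
    by (rule norm_triangle_ineq)
  also have "norm ((W - L) * b0 * adj W) \<le> norm (W - L) * norm b0 * norm (adj W)"
    by (meson mult_right_mono norm_ge_zero norm_mult_ineq order_trans)
  also have "\<dots> \<le> 2 * \<delta> * norm b * 1"
    using WL nb0 nW delta_nonneg[OF n_pos] by (intro mult_mono) auto
  also have "norm (L * b0 * adj (W - L)) \<le> norm L * norm b0 * norm (adj (W - L))"
    by (meson mult_right_mono norm_ge_zero norm_mult_ineq order_trans)
  also have "\<dots> \<le> 1 * norm b * (2 * \<delta>)"
    using WL nb0 nL unfolding norm_adj by (intro mult_mono) auto
  finally have "norm (W * b0 * adj W - b) \<le> 4 * \<delta> * norm b" by simp
  then show thesis using that V.lin_span_twist[OF W_in_C W_unitary b0] by blast
qed

end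

section \<open>Digraph algebras and their star extendible injections\<close>

lemma matrix_unit_carrier [simp]: "matrix_unit n e \<in> carrier_mat n n"
  by (simp add: matrix_unit_def)

lemma matrix_unit_index:
  "i < n \<Longrightarrow> j < n \<Longrightarrow> matrix_unit n e $$ (i, j) = (if (i, j) = e then 1 else 0)"
  by (simp add: matrix_unit_def)

lemma mat_adjoint_carrier: "X \<in> carrier_mat n n \<Longrightarrow> mat_adjoint X \<in> carrier_mat n n"
  by (auto simp: mat_adjoint_def)

lemma mat_adjoint_index:
  fixes X :: "complex mat"
  shows "X \<in> carrier_mat n n \<Longrightarrow> i < n \<Longrightarrow> j < n \<Longrightarrow> mat_adjoint X $$ (i, j) = cnj (X $$ (j, i))"
  by (auto simp: mat_adjoint_def mat_of_rows_index cols_nth)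

lemma mat_mult_index:
  "X \<in> carrier_mat n n \<Longrightarrow> Y \<in> carrier_mat n n \<Longrightarrow> i < n \<Longrightarrow> j < n \<Longrightarrow>
    (X * Y) $$ (i, j) = (\<Sum>k<n. X $$ (i, k) * Y $$ (k, j))"
  by (auto simp: scalar_prod_def lessThan_atLeast0)

lemma digraph_algebra_iff:
  assumes "T \<subseteq> {..<n} \<times> {..<n}"
  shows "X \<in> digraph_algebra n T \<longleftrightarrow>
    X \<in> carrier_mat n n \<and> (\<forall>i<n. \<forall>j<n. (i, j) \<notin> T \<longrightarrow> X $$ (i, j) = 0)"
proof -
  have fin: "finite T" using assms finite_subset by blast
  have entry: "(\<Sum>e\<in>T. a e * matrix_unit n e $$ (i, j)) = (if (i, j) \<in> T then a (i, j) else 0)"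
    if "i < n" "j < n" for a i j
  proof -
    have "(\<Sum>e\<in>T. a e * matrix_unit n e $$ (i, j)) = (\<Sum>e\<in>T. if e = (i, j) then a (i, j) else 0)"
      using that by (intro sum.cong) (auto simp: matrix_unit_index)
    then show ?thesis using fin by simp
  qed
  show ?thesis
  proof
    assume "X \<in> digraph_algebra n T"
    then obtain a where X: "X = mat n n (\<lambda>kl. \<Sum>e\<in>T. a e * matrix_unit n e $$ kl)"
      by (auto simp: digraph_algebra_def)
    show "X \<in> carrier_mat n n \<and> (\<forall>i<n. \<forall>j<n. (i, j) \<notin> T \<longrightarrow> X $$ (i, j) = 0)"
      by (auto simp: X entry)
  next
    assume X: "X \<in> carrier_mat n n \<and> (\<forall>i<n. \<forall>j<n. (i, j) \<notin> T \<longrightarrow> X $$ (i, j) = 0)"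
    have "X = mat n n (\<lambda>kl. \<Sum>e\<in>T. (\<lambda>e. X $$ e) e * matrix_unit n e $$ kl)"
      using X by (intro eq_matI) (auto simp: entry)
    then show "X \<in> digraph_algebra n T" unfolding digraph_algebra_def by blast
  qed
qed

lemma diagonal_masa_eq: "diagonal_masa n = digraph_algebra n (Id_on {..<n})"
proof -
  have "Id_on {..<n} \<subseteq> {..<n} \<times> {..<n}" by auto
  then show ?thesis
    by (auto simp: digraph_algebra_iff diagonal_masa_def diagonal_mat_def Id_on_iff)
qed

lemma matrix_unit_mem: "T \<subseteq> {..<n} \<times> {..<n} \<Longrightarrow> e \<in> T \<Longrightarrow> matrix_unit n e \<in> digraph_algebra n T"
  by (auto simp: digraph_algebra_iff matrix_unit_index)

lemma matrix_unit_mult: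
  assumes "i < n" "j < n" "k < n" "l < n"
  shows "matrix_unit n (i, j) * matrix_unit n (k, l) = (if j = k then matrix_unit n (i, l) else 0\<^sub>m n n)"
proof (rule eq_matI)
  fix r s assume "r < dim_row (if j = k then matrix_unit n (i, l) else 0\<^sub>m n n)"
    "s < dim_col (if j = k then matrix_unit n (i, l) else 0\<^sub>m n n)"
  then have rs: "r < n" "s < n" by (auto simp: matrix_unit_def split: if_splits)
  have "(matrix_unit n (i, j) * matrix_unit n (k, l)) $$ (r, s) =
      (\<Sum>t<n. matrix_unit n (i, j) $$ (r, t) * matrix_unit n (k, l) $$ (t, s))"
    using rs by (intro mat_mult_index) auto
  also have "\<dots> = (\<Sum>t<n. if t = j then (if r = i \<and> j = k \<and> s = l then 1 else 0) else 0)"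
    using rs by (intro sum.cong) (auto simp: matrix_unit_index)
  also have "\<dots> = (if j = k then matrix_unit n (i, l) else 0\<^sub>m n n) $$ (r, s)"
    using rs assms by (auto simp: matrix_unit_index)
  finally show "(matrix_unit n (i, j) * matrix_unit n (k, l)) $$ (r, s) =
      (if j = k then matrix_unit n (i, l) else 0\<^sub>m n n) $$ (r, s)" .
qed (auto simp: matrix_unit_def)

lemma matrix_unit_adjoint: "mat_adjoint (matrix_unit n (i, j)) = matrix_unit n (j, i)"
proof (rule eq_matI)
  have "mat_adjoint (matrix_unit n (i, j)) \<in> carrier_mat n n"
    by (intro mat_adjoint_carrier matrix_unit_carrier)
  then show "dim_row (mat_adjoint (matrix_unit n (i, j))) = dim_row (matrix_unit n (j, i))"
    "dim_col (mat_adjoint (matrix_unit n (i, j))) = dim_col (matrix_unit n (j, i))"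
    by (simp_all add: matrix_unit_def)
  fix r s assume "r < dim_row (matrix_unit n (j, i))" "s < dim_col (matrix_unit n (j, i))"
  then have "r < n" "s < n" by (simp_all add: matrix_unit_def)
  then show "mat_adjoint (matrix_unit n (i, j)) $$ (r, s) = matrix_unit n (j, i) $$ (r, s)"
    by (simp add: mat_adjoint_index[OF matrix_unit_carrier] matrix_unit_index)
qed

lemma mat_star_subalgebra_digraph_algebra:
  assumes R: "equiv {..<n} R"
  shows "mat_star_subalgebra n (digraph_algebra n R)"
proof -
  have sub: "R \<subseteq> {..<n} \<times> {..<n}" and "sym R" "trans R" using R by (auto simp: equiv_def)
  note iff = digraph_algebra_iff[OF sub]
  have mult: "X * Y \<in> digraph_algebra n R"
    if X: "X \<in> digraph_algebra n R" and Y: "Y \<in> digraph_algebra n R" for X Y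
  proof -
    have "(X * Y) $$ (i, k) = 0" if ik: "i < n" "k < n" "(i, k) \<notin> R" for i k
    proof -
      have "X $$ (i, j) * Y $$ (j, k) = 0" if "j < n" for j
        using X Y ik that \<open>trans R\<close> unfolding iff by (metis mult_eq_0_iff transD)
      then show ?thesis
        using X Y ik mat_mult_index[of X n Y i k] unfolding iff by (simp add: sum.neutral)
    qed
    then show ?thesis using X Y by (auto simp: iff)
  qed
  have adjoint: "mat_adjoint X \<in> digraph_algebra n R" if X: "X \<in> digraph_algebra n R" for X
    using X \<open>sym R\<close> mat_adjoint_carrier mat_adjoint_index unfolding iff
    by (metis complex_cnj_zero symD)
  show ?thesis
    unfolding mat_star_subalgebra_def using mult adjoint by (auto simp: iff)
qed

lemma mat_star_subalgebra_generated:
  assumes "B \<subseteq> carrier_mat n n"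
  shows "mat_star_subalgebra n (mat_generated_c_star n B)" "B \<subseteq> mat_generated_c_star n B"
proof -
  have "mat_star_subalgebra n (carrier_mat n n)"
    using mat_adjoint_carrier by (auto simp: mat_star_subalgebra_def)
  then have "mat_generated_c_star n B \<subseteq> carrier_mat n n"
    using assms unfolding mat_generated_c_star_def by blast
  then show "mat_star_subalgebra n (mat_generated_c_star n B)"
    by (auto simp: mat_star_subalgebra_def mat_generated_c_star_def)
  show "B \<subseteq> mat_generated_c_star n B" by (auto simp: mat_generated_c_star_def)
qed

lemma mat_generated_least:
  "B \<subseteq> S \<Longrightarrow> mat_star_subalgebra n S \<Longrightarrow> mat_generated_c_star n B \<subseteq> S"
  by (auto simp: mat_generated_c_star_def)

lemma matrix_unit_normalizer:
  assumes E: "rt_digraph n E" and e: "e \<in> E"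
  shows "matrix_unit n e \<in> mat_masa_normalizer (digraph_algebra n E) (diagonal_masa n)"
proof -
  have sub: "E \<subseteq> {..<n} \<times> {..<n}" using E by (auto simp: rt_digraph_def preorder_on_def)
  obtain i j where ij: "e = (i, j)" by (cases e)
  then have i: "i < n" and j: "j < n" using e sub by auto
  let ?u = "matrix_unit n (i, j)" and ?v = "matrix_unit n (j, i)"
  have corner: "matrix_unit n (a, b) * c * matrix_unit n (b, a) \<in> diagonal_masa n"
    if c: "c \<in> carrier_mat n n" and ab: "a < n" "b < n" for a b c
  proof -
    let ?x = "matrix_unit n (a, b) * c * matrix_unit n (b, a)"
    have "?x $$ (r, s) = 0" if rs: "r < n" "s < n" "r \<noteq> s" for r s
    proof -
      have "?x $$ (r, s) = (\<Sum>t<n. (matrix_unit n (a, b) * c) $$ (r, t) * matrix_unit n (b, a) $$ (t, s))"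
        using c rs by (intro mat_mult_index mult_carrier_mat[of _ n n]) auto
      also have "\<dots> = 0"
      proof (rule sum.neutral, safe)
        fix t assume "t < n"
        have "(matrix_unit n (a, b) * c) $$ (r, t) = (\<Sum>p<n. matrix_unit n (a, b) $$ (r, p) * c $$ (p, t))"
          using c rs \<open>t < n\<close> by (intro mat_mult_index) auto
        then show "(matrix_unit n (a, b) * c) $$ (r, t) * matrix_unit n (b, a) $$ (t, s) = 0"
          using rs \<open>t < n\<close> by (auto simp: matrix_unit_index)
      qed
      finally show ?thesis .
    qed
    then show ?thesis using c by (auto simp: diagonal_masa_def diagonal_mat_def matrix_unit_def)
  qed
  have "?u * ?v * ?u = ?u" using i j by (simp add: matrix_unit_mult)
  moreover have "c \<in> carrier_mat n n" if "c \<in> diagonal_masa n" for c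
    using that by (simp add: diagonal_masa_def)
  ultimately show ?thesis
    using corner[of _ j i] corner[of _ i j] i j matrix_unit_mem[OF sub e]
    by (auto simp: mat_masa_normalizer_def ij matrix_unit_adjoint)
qed

text \<open>The units are the values of the extension at the matrix units of \<open>conn E\<close>, which belong to
  the generated C*-algebra as products of matrix units of \<open>E\<close> and their adjoints.\<close>

lemma matrix_units_of_injection:
  fixes A :: "'a::c_star_algebra set"
  assumes E: "rt_digraph n E" and ext: "star_extendible_injection n (digraph_algebra n E) A \<phi>"
  obtains F where "matrix_units n (conn E) F" "\<And>e. e \<in> E \<Longrightarrow> F e = \<phi> (matrix_unit n e)"
    "\<phi> ` digraph_algebra n E = lin_span F E"
proof -
  let ?B = "digraph_algebra n E"
  let ?M = "mat_generated_c_star n ?B"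
  have sub: "E \<subseteq> {..<n} \<times> {..<n}" using E by (auto simp: rt_digraph_def preorder_on_def)
  have fin: "finite E" using sub finite_subset by blast
  have B: "?B \<subseteq> carrier_mat n n" by (auto simp: digraph_algebra_def)
  have star: "mat_star_subalgebra n ?M" and BM: "?B \<subseteq> ?M"
    using mat_star_subalgebra_generated[OF B] by auto
  have eq: "equiv {..<n} (conn E)" using E by (rule equiv_conn)
  then have bounds: "i < n \<and> j < n" if "(i, j) \<in> conn E" for i j using that by (auto simp: equiv_def)
  obtain \<psi> where hom: "star_hom ?M (generated_c_star A) \<psi>" and inj: "inj_on \<psi> ?M"
    and ext: "\<And>b. b \<in> ?B \<Longrightarrow> \<phi> b = \<psi> b"
    using ext unfolding star_extendible_injection_def by blast
  have add: "\<psi> (X + Y) = \<psi> X + \<psi> Y" if "X \<in> ?M" "Y \<in> ?M" for X Y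
    using hom that by (auto simp: star_hom_def)
  have smult: "\<psi> (a \<cdot>\<^sub>m X) = scaleC a (\<psi> X)" if "X \<in> ?M" for a X
    using hom that by (auto simp: star_hom_def)
  have mult: "\<psi> (X * Y) = \<psi> X * \<psi> Y" if "X \<in> ?M" "Y \<in> ?M" for X Y
    using hom that by (auto simp: star_hom_def)
  have adjoint: "\<psi> (mat_adjoint X) = adj (\<psi> X)" if "X \<in> ?M" for X
    using hom that by (auto simp: star_hom_def)
  have zero_mem: "0\<^sub>m n n \<in> ?M" using star by (simp add: mat_star_subalgebra_def)
  have "0 \<cdot>\<^sub>m 0\<^sub>m n n = (0\<^sub>m n n :: complex mat)" by (intro eq_matI) auto
  then have zero: "\<psi> (0\<^sub>m n n) = 0" using smult[OF zero_mem, of 0] by simp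
  define F where "F e = \<psi> (matrix_unit n e)" for e
  have base: "matrix_unit n e \<in> ?M" if "e \<in> E" for e
    using matrix_unit_mem[OF sub that] BM by blast
  have base': "matrix_unit n e \<in> ?M" if "e \<in> E \<union> E\<inverse>" for e
  proof (cases "e \<in> E")
    case False
    then obtain i j where ij: "e = (i, j)" "(j, i) \<in> E" using \<open>e \<in> E \<union> E\<inverse>\<close> by (cases e) auto
    have "mat_adjoint (matrix_unit n (j, i)) \<in> ?M"
      using base[OF ij(2)] star unfolding mat_star_subalgebra_def by blast
    then show ?thesis by (simp add: ij(1) matrix_unit_adjoint)
  qed (rule base)
  have mem: "matrix_unit n (i, j) \<in> ?M" if "(i, j) \<in> conn E" for i j
    using that unfolding conn_def
  proof (induction rule: trancl_induct)
    case (base j)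
    then show ?case by (rule base')
  next
    case (step j k)
    have "i < n" "j < n" "k < n"
      using bounds[of i j] bounds[of j k] step.hyps by (auto simp: conn_def)
    then have "matrix_unit n (i, k) = matrix_unit n (i, j) * matrix_unit n (j, k)"
      by (simp add: matrix_unit_mult)
    then show ?case
      using step.IH base'[OF step.hyps(2)] star unfolding mat_star_subalgebra_def by metis
  qed
  have units: "matrix_units n (conn E) F"
  proof
    show "equiv {..<n} (conn E)" by (rule eq)
    fix i j
    show "F (i, j) * F (k, l) = (if j = k then F (i, l) else 0)"
      if "(i, j) \<in> conn E" "(k, l) \<in> conn E" for k l
      using that mult[OF mem mem, of i j k l] bounds zero by (auto simp: F_def matrix_unit_mult)
    show "adj (F (i, j)) = F (j, i)" if "(i, j) \<in> conn E"
      using adjoint[OF mem[OF that]] by (simp add: F_def matrix_unit_adjoint)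
  next
    fix i assume i: "i < n"
    have "(i, i) \<in> conn E" using eq i by (auto simp: equiv_def refl_on_def)
    moreover have "matrix_unit n (i, i) \<noteq> 0\<^sub>m n n"
    proof
      assume "matrix_unit n (i, i) = 0\<^sub>m n n"
      then have "matrix_unit n (i, i) $$ (i, i) = 0" using i by simp
      then show False using i by (simp add: matrix_unit_index)
    qed
    ultimately show "F (i, i) \<noteq> 0"
      using inj mem zero zero_mem unfolding F_def by (metis inj_onD)
  qed
  have evaluation: "mat n n (\<lambda>kl. \<Sum>e\<in>T. a e * matrix_unit n e $$ kl) \<in> ?M \<and>
      \<psi> (mat n n (\<lambda>kl. \<Sum>e\<in>T. a e * matrix_unit n e $$ kl)) = (\<Sum>e\<in>T. scaleC (a e) (F e))"
    if "T \<subseteq> E" for T a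
    using finite_subset[OF that fin] that
  proof (induction T rule: finite_induct)
    case empty
    have "mat n n (\<lambda>kl. \<Sum>e\<in>{}. a e * matrix_unit n e $$ kl) = 0\<^sub>m n n" by (intro eq_matI) auto
    then show ?case using zero zero_mem by simp
  next
    case (insert e T)
    let ?rest = "mat n n (\<lambda>kl. \<Sum>e\<in>T. a e * matrix_unit n e $$ kl)"
    have eq: "mat n n (\<lambda>kl. \<Sum>e\<in>insert e T. a e * matrix_unit n e $$ kl) =
        a e \<cdot>\<^sub>m matrix_unit n e + ?rest"
      using insert.hyps by (intro eq_matI) (auto simp: matrix_unit_def)
    have e: "matrix_unit n e \<in> ?M" "a e \<cdot>\<^sub>m matrix_unit n e \<in> ?M"
      using base insert.prems star unfolding mat_star_subalgebra_def by auto
    have rest: "?rest \<in> ?M" "\<psi> ?rest = (\<Sum>e\<in>T. scaleC (a e) (F e))"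
      using insert.IH insert.prems by auto
    have "a e \<cdot>\<^sub>m matrix_unit n e + ?rest \<in> ?M"
      using star e rest unfolding mat_star_subalgebra_def by blast
    then show ?case
      unfolding eq using add[OF e(2) rest(1)] smult[OF e(1)] rest(2) insert.hyps by (simp add: F_def)
  qed
  have "\<phi> ` ?B = lin_span F E"
  proof -
    have "\<phi> ` ?B = \<psi> ` ?B" using ext by (intro image_cong) auto
    also have "\<dots> = lin_span F E"
      unfolding digraph_algebra_def lin_span_def using evaluation[OF order_refl] by (auto simp: image_iff) metis
    finally show ?thesis .
  qed
  moreover have "F e = \<phi> (matrix_unit n e)" if "e \<in> E" for e
    using ext[OF matrix_unit_mem[OF sub that]] by (simp add: F_def)
  ultimately show thesis using that units by blast
qed

lemma regular_units_of_injection: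
  fixes A :: "'a::c_star_algebra set"
  assumes "operator_masa A C" and E: "rt_digraph n E"
    and ext: "star_extendible_injection n (digraph_algebra n E) A \<phi>"
    and reg: "regular_map (digraph_algebra n E) (diagonal_masa n) A C \<phi>"
  obtains F where "regular_units A C n E F" "\<phi> ` digraph_algebra n E = lin_span F E"
proof -
  obtain F where F: "matrix_units n (conn E) F" "\<And>e. e \<in> E \<Longrightarrow> F e = \<phi> (matrix_unit n e)"
    "\<phi> ` digraph_algebra n E = lin_span F E"
    using matrix_units_of_injection[OF E ext] by blast
  have "F e \<in> masa_normalizer A C" if "e \<in> E" for e
    using matrix_unit_normalizer[OF E that] reg F(2)[OF that] unfolding regular_map_def by auto
  then have "regular_units A C n E F"
    using assms(1) E F(1) unfolding regular_units_def regular_units_axioms_def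
    by (auto simp: masa_normalizer_iff)
  then show thesis using that F(3) by blast
qed

context matrix_units
begin

text \<open>The map of matrices defined by the units. The sum runs over all positions, including those
  where \<open>F\<close> is not a unit, so that no index set enters; the matrices to which it is applied
  vanish there.\<close>

definition realize :: "complex mat \<Rightarrow> 'a" where
  "realize X = (\<Sum>i<n. \<Sum>j<n. scaleC (X $$ (i, j)) (F (i, j)))"

lemma R_subset: "R \<subseteq> {..<n} \<times> {..<n}" using R_bounds by auto

lemma realize_eq:
  assumes T: "T \<subseteq> R" and X: "X \<in> digraph_algebra n T"
  shows "realize X = (\<Sum>e\<in>T. scaleC (X $$ e) (F e))"
proof -
  have "realize X = (\<Sum>e\<in>{..<n} \<times> {..<n}. scaleC (X $$ e) (F e))"
    by (simp add: realize_def sum.cartesian_product)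
  also have "\<dots> = (\<Sum>e\<in>T. scaleC (X $$ e) (F e))"
    using X T R_subset digraph_algebra_iff[of T n X] by (intro sum.mono_neutral_right) auto
  finally show ?thesis .
qed

lemma realize_image:
  assumes T: "T \<subseteq> R"
  shows "realize ` digraph_algebra n T = lin_span F T"
proof -
  have sub: "T \<subseteq> {..<n} \<times> {..<n}" using T R_subset by blast
  have "x \<in> realize ` digraph_algebra n T" if "x \<in> lin_span F T" for x
  proof -
    obtain a where x: "x = (\<Sum>e\<in>T. scaleC (a e) (F e))"
      using \<open>x \<in> lin_span F T\<close> by (auto simp: lin_span_def)
    define X where "X = mat n n (\<lambda>e. if e \<in> T then a e else 0)"
    have X: "X \<in> digraph_algebra n T" by (auto simp: digraph_algebra_iff[OF sub] X_def)
    have "realize X = x"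
      unfolding realize_eq[OF T X] x using sub by (intro sum.cong) (auto simp: X_def)
    then show ?thesis using X by blast
  qed
  then show ?thesis using realize_eq[OF T] by (auto simp: lin_spanI)
qed

lemma realize_mult:
  assumes X: "X \<in> digraph_algebra n R" and Y: "Y \<in> digraph_algebra n R"
  shows "realize (X * Y) = realize X * realize Y"
proof -
  note iff = digraph_algebra_iff[OF R_subset]
  have entry: "scaleC (X $$ (i, j)) (F (i, j)) * scaleC (Y $$ (k, l)) (F (k, l)) =
      (if j = k then scaleC (X $$ (i, j) * Y $$ (j, l)) (F (i, l)) else 0)"
    if "i < n" "j < n" "k < n" "l < n" for i j k l
  proof (cases "(i, j) \<in> R \<and> (k, l) \<in> R")
    case True
    then show ?thesis
      by (auto simp: F_mult mult_scaleC_left mult_scaleC_right scaleC_scaleC mult.commute)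
  next
    case False
    then have "X $$ (i, j) = 0 \<or> Y $$ (k, l) = 0" using X Y that unfolding iff by blast
    then show ?thesis by auto
  qed
  have "realize X * realize Y =
      (\<Sum>i<n. \<Sum>j<n. \<Sum>k<n. \<Sum>l<n. scaleC (X $$ (i, j)) (F (i, j)) * scaleC (Y $$ (k, l)) (F (k, l)))"
    by (simp only: realize_def sum_distrib_right) (simp only: sum_distrib_left)
  also have "\<dots> = (\<Sum>i<n. \<Sum>j<n. \<Sum>k<n. if k = j then (\<Sum>l<n. scaleC (X $$ (i, j) * Y $$ (j, l)) (F (i, l))) else 0)"
    by (intro sum.cong refl) (auto simp: entry)
  also have "\<dots> = (\<Sum>i<n. \<Sum>j<n. \<Sum>l<n. scaleC (X $$ (i, j) * Y $$ (j, l)) (F (i, l)))"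
    by simp
  also have "\<dots> = (\<Sum>i<n. \<Sum>l<n. \<Sum>j<n. scaleC (X $$ (i, j) * Y $$ (j, l)) (F (i, l)))"
    by (intro sum.cong refl sum.swap)
  also have "\<dots> = (\<Sum>i<n. \<Sum>l<n. scaleC ((X * Y) $$ (i, l)) (F (i, l)))"
  proof (intro sum.cong refl)
    fix i l assume "i \<in> {..<n}" "l \<in> {..<n}"
    then have "(X * Y) $$ (i, l) = (\<Sum>j<n. X $$ (i, j) * Y $$ (j, l))"
      using X Y by (intro mat_mult_index) (auto simp: iff)
    moreover have "(\<Sum>j<n. scaleC (b j) x) = scaleC (\<Sum>j<n. b j) x" for b and x :: 'a
      by (induction n) (auto simp: scaleC_add_left)
    ultimately show "(\<Sum>j<n. scaleC (X $$ (i, j) * Y $$ (j, l)) (F (i, l))) =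
      scaleC ((X * Y) $$ (i, l)) (F (i, l))" by simp
  qed
  finally show ?thesis by (simp add: realize_def)
qed

lemma realize_adjoint:
  assumes X: "X \<in> digraph_algebra n R"
  shows "realize (mat_adjoint X) = adj (realize X)"
proof -
  note iff = digraph_algebra_iff[OF R_subset]
  have "adj (realize X) = (\<Sum>i<n. \<Sum>j<n. scaleC (cnj (X $$ (i, j))) (adj (F (i, j))))"
    by (simp add: realize_def adj_sum adj_scaleC)
  also have "\<dots> = (\<Sum>i<n. \<Sum>j<n. scaleC (mat_adjoint X $$ (j, i)) (F (j, i)))"
  proof (intro sum.cong refl)
    fix i j assume ij: "i \<in> {..<n}" "j \<in> {..<n}"
    have *: "mat_adjoint X $$ (j, i) = cnj (X $$ (i, j))"
      using X ij by (intro mat_adjoint_index) (auto simp: iff)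
    show "scaleC (cnj (X $$ (i, j))) (adj (F (i, j))) = scaleC (mat_adjoint X $$ (j, i)) (F (j, i))"
    proof (cases "(i, j) \<in> R")
      case False
      then have "X $$ (i, j) = 0" using X ij unfolding iff by auto
      then show ?thesis by (simp add: *)
    qed (simp add: * F_adj)
  qed
  also have "\<dots> = realize (mat_adjoint X)" unfolding realize_def by (rule sum.swap)
  finally show ?thesis by simp
qed

lemma inj_realize: "inj_on realize (digraph_algebra n R)"
proof (rule inj_onI)
  note iff = digraph_algebra_iff[OF R_subset]
  fix X Y assume X: "X \<in> digraph_algebra n R" and Y: "Y \<in> digraph_algebra n R"
    and eq: "realize X = realize Y"
  have "X $$ (i, j) = Y $$ (i, j)" if ij: "i < n" "j < n" for i j
  proof (cases "(i, j) \<in> R")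
    case True
    then have "q i * realize Z * q j = scaleC (Z $$ (i, j)) (F (i, j))"
      if "Z \<in> digraph_algebra n R" for Z
      using realize_eq[OF order_refl that] corner_sum[OF order_refl ij, of "\<lambda>e. Z $$ e"] by simp
    then have "scaleC (X $$ (i, j)) (F (i, j)) = scaleC (Y $$ (i, j)) (F (i, j))"
      using X Y eq by metis
    then have "scaleC (X $$ (i, j) - Y $$ (i, j)) (F (i, j)) = 0" by (simp add: scaleC_diff_left)
    then show ?thesis using F_neq_0[OF True] by simp
  next
    case False
    then show ?thesis using X Y ij unfolding iff by simp
  qed
  then show "X = Y" using X Y by (intro eq_matI) (auto simp: iff)
qed

end

lemma (in regular_units) realize_star_extendible:
  "star_extendible_injection n (digraph_algebra n E) A realize"
proof -
  let ?M = "mat_generated_c_star n (digraph_algebra n E)"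
  have EB: "E \<subseteq> {..<n} \<times> {..<n}" using subset_conn R_subset by blast
  have "digraph_algebra n E \<subseteq> digraph_algebra n (conn E)"
    unfolding subset_iff digraph_algebra_iff[OF EB] digraph_algebra_iff[OF R_subset]
    using subset_conn[of E] by blast
  then have M: "?M \<subseteq> digraph_algebra n (conn E)"
    by (intro mat_generated_least mat_star_subalgebra_digraph_algebra equiv_R)
  have carr: "X \<in> carrier_mat n n" if "X \<in> ?M" for X
    using M that digraph_algebra_iff[OF R_subset] by blast
  have "star_hom ?M D realize"
    unfolding star_hom_def
  proof (intro conjI ballI allI)
    fix X assume X: "X \<in> ?M"
    then have "realize X \<in> lin_span F (conn E)" using realize_image[OF order_refl] M by blast
    then show "realize X \<in> D" using span_R_subset_D by blast
    show "realize (a \<cdot>\<^sub>m X) = scaleC a (realize X)" for a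
      using carr[OF X] by (simp add: realize_def scaleC_sum_right scaleC_scaleC)
    show "realize (mat_adjoint X) = adj (realize X)" using realize_adjoint X M by blast
    fix Y assume Y: "Y \<in> ?M"
    show "realize (X + Y) = realize X + realize Y"
      using carr[OF X] carr[OF Y] by (simp add: realize_def scaleC_add_left sum.distrib)
    show "realize (X * Y) = realize X * realize Y" using realize_mult X Y M by blast
  qed
  moreover have "inj_on realize ?M" using inj_realize M by (rule inj_on_subset)
  moreover have "realize ` digraph_algebra n E \<subseteq> A"
    using realize_image[OF subset_conn] span_E_subset_A by simp
  ultimately show ?thesis unfolding star_extendible_injection_def by blast
qed

section \<open>Approximation in the generated C*-algebra\<close>

text \<open>The hypothesis of the theorem controls \<open>A\<close> only, but the adjoints of the matrix units may
  lie outside \<open>A\<close>. Since *-polynomials are continuous, a *-subalgebra that is close to a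
  suitable finite subset of \<open>A\<close> is close to a given element of \<open>C\<^sup>*(A)\<close>.\<close>

definition controlled :: "'a::c_star_algebra set \<Rightarrow> 'a \<Rightarrow> real \<Rightarrow> bool" where
  "controlled A x \<epsilon> \<longleftrightarrow> (\<exists>S \<delta>. finite S \<and> S \<subseteq> A \<and> \<delta> > 0 \<and>
     (\<forall>M. star_subalgebra M \<and> (\<forall>s\<in>S. \<exists>b\<in>M. norm (s - b) < \<delta>) \<longrightarrow> (\<exists>b\<in>M. norm (x - b) < \<epsilon>)))"

lemma controlled_combine:
  assumes x: "controlled A x \<eta>" and y: "controlled A y \<theta>"
    and comb: "\<And>M b c. star_subalgebra M \<Longrightarrow> b \<in> M \<Longrightarrow> c \<in> M \<Longrightarrow> norm (x - b) < \<eta> \<Longrightarrow>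
      norm (y - c) < \<theta> \<Longrightarrow> \<exists>d\<in>M. norm (z - d) < \<epsilon>"
  shows "controlled A z \<epsilon>"
proof -
  obtain S d T e where S: "finite S" "S \<subseteq> A" "d > 0"
    "\<And>M. star_subalgebra M \<Longrightarrow> \<forall>s\<in>S. \<exists>b\<in>M. norm (s - b) < d \<Longrightarrow> \<exists>b\<in>M. norm (x - b) < \<eta>"
    and T: "finite T" "T \<subseteq> A" "e > 0"
    "\<And>M. star_subalgebra M \<Longrightarrow> \<forall>s\<in>T. \<exists>b\<in>M. norm (s - b) < e \<Longrightarrow> \<exists>b\<in>M. norm (y - b) < \<theta>"
    using x y unfolding controlled_def by metis
  have "\<exists>b\<in>M. norm (z - b) < \<epsilon>"
    if "star_subalgebra M" and near: "\<forall>s\<in>S \<union> T. \<exists>b\<in>M. norm (s - b) < min d e" for M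
  proof -
    have "\<forall>s\<in>S. \<exists>b\<in>M. norm (s - b) < d" "\<forall>s\<in>T. \<exists>b\<in>M. norm (s - b) < e"
      using near by (meson UnI1 UnI2 min_less_iff_conj)+
    then show ?thesis using S(4) T(4) comb that(1) by metis
  qed
  then show ?thesis
    unfolding controlled_def using S(1-3) T(1-3)
    by (intro exI[of _ "S \<union> T"] exI[of _ "min d e"]) auto
qed

lemma controlled_base: "x \<in> A \<Longrightarrow> \<epsilon> > 0 \<Longrightarrow> controlled A x \<epsilon>"
  unfolding controlled_def by (intro exI[of _ "{x}"] exI[of _ \<epsilon>]) auto

lemma controlled_generated:
  fixes A :: "'a::c_star_algebra set"
  assumes "x \<in> generated_c_star A" "\<epsilon> > 0"
  shows "controlled A x \<epsilon>"
proof -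
  define Z where "Z = {x. \<forall>\<epsilon>>0. controlled A x \<epsilon>}"
  have Zd: "controlled A x \<epsilon>" if "x \<in> Z" "\<epsilon> > 0" for x \<epsilon> using that by (simp add: Z_def)
  have "star_subalgebra Z"
    unfolding star_subalgebra_def complex_subalgebra_def
  proof (intro conjI ballI allI)
    show "0 \<in> Z"
      unfolding Z_def controlled_def
      by (intro CollectI allI impI exI[of _ "{}"] exI[of _ 1])
        (auto dest: star_subalgebraD(1) intro!: bexI[of _ 0])
    fix x assume x: "x \<in> Z"
    show "adj x \<in> Z"
      unfolding Z_def
    proof (intro CollectI allI impI)
      fix \<epsilon> :: real assume "\<epsilon> > 0"
      show "controlled A (adj x) \<epsilon>"
      proof (rule controlled_combine[OF Zd[OF x \<open>\<epsilon> > 0\<close>] Zd[OF x \<open>\<epsilon> > 0\<close>]])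
        fix M and b :: 'a assume "star_subalgebra M" "b \<in> M" "norm (x - b) < \<epsilon>"
        then show "\<exists>d\<in>M. norm (adj x - d) < \<epsilon>"
          by (intro bexI[of _ "adj b"]) (auto simp: adj_diff[symmetric] star_subalgebraD)
      qed
    qed
    show "scaleC a x \<in> Z" for a
      unfolding Z_def
    proof (intro CollectI allI impI)
      fix \<epsilon> :: real assume "\<epsilon> > 0"
      define \<eta> where "\<eta> = \<epsilon> / (cmod a + 1)"
      have pos: "cmod a + 1 > 0" by (simp add: add_nonneg_pos)
      then have eta: "\<eta> > 0" "\<eta> * (cmod a + 1) = \<epsilon>" using \<open>\<epsilon> > 0\<close> by (auto simp: \<eta>_def)
      show "controlled A (scaleC a x) \<epsilon>"
      proof (rule controlled_combine[OF Zd[OF x eta(1)] Zd[OF x eta(1)]])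
        fix M and b :: 'a assume M: "star_subalgebra M" "b \<in> M" "norm (x - b) < \<eta>"
        have "norm (scaleC a x - scaleC a b) = cmod a * norm (x - b)"
          using scaleC_add_right[of a x "- b"] by (simp add: norm_scaleC[symmetric] scaleC_minus_right)
        also have "\<dots> \<le> cmod a * \<eta>" using M(3) by (intro mult_left_mono) auto
        also have "\<dots> < \<epsilon>" using eta by (simp add: algebra_simps)
        finally show "\<exists>d\<in>M. norm (scaleC a x - d) < \<epsilon>"
          using M by (intro bexI[of _ "scaleC a b"]) (auto simp: star_subalgebraD)
      qed
    qed
    fix y assume y: "y \<in> Z"
    show "x + y \<in> Z"
      unfolding Z_def
    proof (intro CollectI allI impI)
      fix \<epsilon> :: real assume "\<epsilon> > 0"
      then have h: "\<epsilon> / 2 > 0" by simp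
      show "controlled A (x + y) \<epsilon>"
      proof (rule controlled_combine[OF Zd[OF x h] Zd[OF y h]])
        fix M and b c :: 'a
        assume M: "star_subalgebra M" "b \<in> M" "c \<in> M" "norm (x - b) < \<epsilon> / 2" "norm (y - c) < \<epsilon> / 2"
        then have "norm ((x + y) - (b + c)) < \<epsilon>"
          using norm_triangle_ineq[of "x - b" "y - c"] by (simp add: add_diff_add)
        then show "\<exists>d\<in>M. norm (x + y - d) < \<epsilon>" using M by (metis star_subalgebraD(2))
      qed
    qed
    show "x * y \<in> Z"
      unfolding Z_def
    proof (intro CollectI allI impI)
      fix \<epsilon> :: real assume "\<epsilon> > 0"
      define K where "K = norm x + norm y + 2"
      define \<eta> where "\<eta> = min 1 (\<epsilon> / K)"
      have K: "K > 0" by (simp add: K_def add_nonneg_pos)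
      then have eta: "\<eta> > 0" "\<eta> \<le> 1" "\<eta> * K \<le> \<epsilon>"
        using \<open>\<epsilon> > 0\<close> by (auto simp: \<eta>_def min_def field_simps)
      show "controlled A (x * y) \<epsilon>"
      proof (rule controlled_combine[OF Zd[OF x eta(1)] Zd[OF y eta(1)]])
        fix M and b c :: 'a
        assume M: "star_subalgebra M" "b \<in> M" "c \<in> M" "norm (x - b) < \<eta>" "norm (y - c) < \<eta>"
        have "norm b \<le> norm x + 1"
          using norm_triangle_ineq2[of b x] M(4) eta(2) by (simp add: norm_minus_commute)
        have "x * y - b * c = (x - b) * y + b * (y - c)" by (simp add: algebra_simps)
        also have "norm \<dots> \<le> norm ((x - b) * y) + norm (b * (y - c))" by (rule norm_triangle_ineq)
        also have "\<dots> \<le> \<eta> * norm y + (norm x + 1) * \<eta>"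
          using M(4,5) \<open>norm b \<le> norm x + 1\<close> eta(1)
          by (intro add_mono order_trans[OF norm_mult_ineq] mult_mono) auto
        also have "\<dots> < \<eta> * K" using eta(1) by (simp add: K_def algebra_simps)
        finally have "norm (x * y - b * c) < \<epsilon>" using eta(3) by simp
        then show "\<exists>d\<in>M. norm (x * y - d) < \<epsilon>" using M by (metis star_subalgebraD(4))
      qed
    qed
  qed
  moreover have "closed Z"
    unfolding closure_subset_eq[symmetric]
  proof
    fix x assume x: "x \<in> closure Z"
    show "x \<in> Z"
      unfolding Z_def
    proof (intro CollectI allI impI)
      fix \<epsilon> :: real assume "\<epsilon> > 0"
      then have h: "\<epsilon> / 2 > 0" by simp
      then obtain y where y: "y \<in> Z" "norm (y - x) < \<epsilon> / 2"
        using x unfolding closure_approachable dist_norm by blast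
      show "controlled A x \<epsilon>"
      proof (rule controlled_combine[OF Zd[OF y(1) h] Zd[OF y(1) h]])
        fix M and b :: 'a assume "b \<in> M" "norm (y - b) < \<epsilon> / 2"
        moreover have "norm (x - b) \<le> norm (y - x) + norm (y - b)"
          using norm_triangle_ineq[of "x - y" "y - b"] by (simp add: norm_minus_commute)
        ultimately show "\<exists>d\<in>M. norm (x - d) < \<epsilon>" using y(2) by (intro bexI[of _ b]) auto
      qed
    qed
  qed
  moreover have "A \<subseteq> Z" using controlled_base by (auto simp: Z_def)
  ultimately show ?thesis using generated_c_star_least[of A Z] assms by (auto simp: Z_def)
qed

lemma controlled_finite:
  fixes A :: "'a::c_star_algebra set"
  assumes "finite T" "T \<subseteq> generated_c_star A" "\<epsilon> > 0"
  obtains S \<delta> where "finite S" "S \<subseteq> A" "\<delta> > 0"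
    "\<And>M. star_subalgebra M \<Longrightarrow> \<forall>s\<in>S. \<exists>b\<in>M. norm (s - b) < \<delta> \<Longrightarrow> \<forall>x\<in>T. \<exists>b\<in>M. norm (x - b) < \<epsilon>"
proof -
  have "\<forall>x\<in>T. \<exists>S \<delta>. finite S \<and> S \<subseteq> A \<and> \<delta> > 0 \<and> (\<forall>M. star_subalgebra M \<and>
      (\<forall>s\<in>S. \<exists>b\<in>M. norm (s - b) < \<delta>) \<longrightarrow> (\<exists>b\<in>M. norm (x - b) < \<epsilon>))"
    using controlled_generated[OF _ assms(3)] assms(2) unfolding controlled_def by blast
  then obtain S d where Sd: "\<And>x. x \<in> T \<Longrightarrow> finite (S x) \<and> S x \<subseteq> A \<and> d x > 0 \<and>
      (\<forall>M. star_subalgebra M \<and> (\<forall>s\<in>S x. \<exists>b\<in>M. norm (s - b) < d x) \<longrightarrow> (\<exists>b\<in>M. norm (x - b) < \<epsilon>))"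
    by metis
  define \<delta> where "\<delta> = Min (insert 1 (d ` T))"
  have "\<delta> > 0" using assms(1) Sd by (auto simp: \<delta>_def)
  have le: "\<delta> \<le> d x" if "x \<in> T" for x using that assms(1) by (auto simp: \<delta>_def)
  show thesis
  proof (rule that[of "\<Union>x\<in>T. S x" \<delta>])
    fix M assume M: "star_subalgebra M" "\<forall>s\<in>\<Union>x\<in>T. S x. \<exists>b\<in>M. norm (s - b) < \<delta>"
    show "\<forall>x\<in>T. \<exists>b\<in>M. norm (x - b) < \<epsilon>"
    proof
      fix x assume x: "x \<in> T"
      have "\<forall>s\<in>S x. \<exists>b\<in>M. norm (s - b) < d x"
        using M(2) le[OF x] x by (meson UN_I less_le_trans)
      then show "\<exists>b\<in>M. norm (x - b) < \<epsilon>" using Sd[OF x] M(1) by blast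
    qed
  qed (use assms(1) Sd \<open>\<delta> > 0\<close> in auto)
qed

section \<open>Chains of regular systems\<close>

context operator_masa
begin

definition locally_regular :: bool where
  "locally_regular \<longleftrightarrow> (\<forall>\<epsilon>>0. \<forall>S. finite S \<and> S \<subseteq> A \<longrightarrow>
     (\<exists>n E F. regular_units A C n E F \<and> (\<forall>s\<in>S. \<exists>b\<in>lin_span F E. norm (s - b) < \<epsilon>)))"

lemma locally_regular_separates:
  assumes locally_regular
  shows projections_separate
proof (rule projections_separateI)
  fix c and \<epsilon> :: real assume "c \<in> C" "\<epsilon> > 0"
  then obtain n E F b where "regular_units A C n E F" "b \<in> lin_span F E" "norm (c - b) < \<epsilon>"
    using assms C_subset_A unfolding locally_regular_def by (metis empty_subsetI finite.emptyI finite_insert insert_subset insertI1 subsetD)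
  then show "\<exists>n E F. regular_units A C n E F \<and> (\<exists>b\<in>lin_span F (conn E). norm (c - b) < \<epsilon>)"
    using regular_units.span_E_subset_span_R by blast
qed

text \<open>The accuracy \<open>\<delta>\<close> must be chosen before the new system is known. The twist moves an
  approximant \<open>b\<close> of \<open>s\<close> by at most \<open>4\<delta>\<parallel>b\<parallel>\<close>, where \<open>\<parallel>b\<parallel>\<close> is at most \<open>K\<close>; this bound does not
  involve the size of the new system.\<close>

lemma extend_regular_units:
  assumes loc: locally_regular and units: "regular_units A C n E F"
    and S: "finite S" "S \<subseteq> A" and "\<epsilon> > 0"
  obtains m G H where "regular_units A C m G H" "lin_span F E \<subseteq> lin_span H G"
    "\<forall>s\<in>S. \<exists>b\<in>lin_span H G. norm (s - b) < \<epsilon>"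
proof -
  interpret U: regular_units A C n E F by (rule units)
  define K where "K = (\<Sum>s\<in>S. norm s) + 1"
  have K: "K \<ge> 1" "norm s + 1 \<le> K" if "s \<in> S" for s
    using S(1) that member_le_sum[of s S norm] by (auto simp: K_def sum_nonneg)
  have "K \<ge> 1" by (simp add: K_def sum_nonneg)
  define \<delta> where "\<delta> = min (1 / 4) (\<epsilon> / (4 * K + 2))"
  have small: "\<delta> > 0" "\<delta> < 1 / 2" "\<delta> * (4 * K + 1) < \<epsilon>"
  proof -
    show "\<delta> > 0" "\<delta> < 1 / 2" using \<open>\<epsilon> > 0\<close> \<open>K \<ge> 1\<close> by (auto simp: \<delta>_def)
    have "\<delta> \<le> \<epsilon> / (4 * K + 2)" by (simp add: \<delta>_def)
    then have "\<delta> * (4 * K + 2) \<le> \<epsilon>" using \<open>K \<ge> 1\<close> by (simp add: pos_le_divide_eq)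
    then show "\<delta> * (4 * K + 1) < \<epsilon>" using \<open>\<delta> > 0\<close> by (simp add: algebra_simps)
  qed
  have "finite (F ` conn E)" "F ` conn E \<subseteq> D" using U.finite_R U.F_in_D by auto
  then obtain S1 \<delta>1 where S1: "finite S1" "S1 \<subseteq> A" "\<delta>1 > 0"
    "\<And>M. star_subalgebra M \<Longrightarrow> \<forall>s\<in>S1. \<exists>b\<in>M. norm (s - b) < \<delta>1 \<Longrightarrow>
      \<forall>x\<in>F ` conn E. \<exists>b\<in>M. norm (x - b) < \<delta>"
    using controlled_finite[of "F ` conn E" A \<delta>] small(1) by blast
  have "finite (S \<union> S1 \<union> F ` E)" "S \<union> S1 \<union> F ` E \<subseteq> A" "min \<delta> \<delta>1 > 0"
    using S S1 U.finite_E U.F_in_A small by auto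
  then obtain m G H where V: "regular_units A C m G H"
    and near: "\<forall>s\<in>S \<union> S1 \<union> F ` E. \<exists>b\<in>lin_span H G. norm (s - b) < min \<delta> \<delta>1"
    using loc unfolding locally_regular_def by meson
  interpret V: regular_units A C m G H by (rule V)
  have nearS1: "\<forall>s\<in>S1. \<exists>b\<in>lin_span H (conn G). norm (s - b) < \<delta>1"
    using near V.span_E_subset_span_R by (meson UnI1 UnI2 min_less_iff_conj subsetD)
  interpret absorption A C n E F m G H \<delta>
  proof
    show "\<delta> < 1 / 2" by (rule small)
    show projections_separate by (rule locally_regular_separates[OF loc])
    show "\<exists>b\<in>lin_span H (conn G). norm (F e - b) < \<delta>" if "e \<in> conn E" for e
      using S1(4)[OF V.star_R nearS1] that by blast
    show "\<exists>b\<in>lin_span H G. norm (F e - b) < \<delta>" if "e \<in> E" for e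
      using near that by (meson UnI2 imageI min_less_iff_conj)
  qed
  show thesis
  proof (rule that[OF regular_units_H'])
    show "lin_span F E \<subseteq> lin_span H' G"
      using regular_units.E_trans[OF regular_units_H'] regular_units_H'
      by (intro lin_span_subset F_in_span matrix_units.complex_subalgebra_lin_span[of m "conn G"] subset_conn)
        (auto simp: regular_units_def)
    show "\<forall>s\<in>S. \<exists>b\<in>lin_span H' G. norm (s - b) < \<epsilon>"
    proof
      fix s assume s: "s \<in> S"
      then obtain b where b: "b \<in> lin_span H G" "norm (s - b) < \<delta>"
        using near by (meson UnI1 min_less_iff_conj)
      obtain b' where b': "b' \<in> lin_span H' G" "norm (b' - b) \<le> 4 * \<delta> * norm b"
        using span_near_twist[OF b(1)] by blast
      have "norm b \<le> K"
        using norm_triangle_ineq2[of b s] b(2) small K(2)[OF s] by (simp add: norm_minus_commute)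
      then have "4 * \<delta> * norm b \<le> 4 * \<delta> * K" using small by (intro mult_left_mono) auto
      moreover have "norm (s - b') \<le> norm (s - b) + norm (b' - b)"
        using norm_triangle_ineq[of "s - b" "b - b'"] by (simp add: norm_minus_commute)
      ultimately have "norm (s - b') < \<epsilon>"
        using b(2) b'(2) small(3) by (simp add: algebra_simps)
      then show "\<exists>b\<in>lin_span H' G. norm (s - b) < \<epsilon>" using b'(1) by blast
    qed
  qed
qed

lemma chain_of_regular_units:
  assumes loc: locally_regular and s: "range s \<subseteq> A"
  obtains n E F where "\<And>k. regular_units A C (n k) (E k) (F k)"
    "\<And>k. lin_span (F k) (E k) \<subseteq> lin_span (F (Suc k)) (E (Suc k))"
    "\<And>j k. j \<le> k \<Longrightarrow> \<exists>b\<in>lin_span (F k) (E k). norm (s j - b) < 1 / Suc k"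
proof -
  define P where "P k \<sigma> \<longleftrightarrow> (case \<sigma> of (n, E, F) \<Rightarrow> regular_units A C n E F \<and>
      (\<forall>x\<in>s ` {..k}. \<exists>b\<in>lin_span F E. norm (x - b) < 1 / Suc k))" for k \<sigma>
  define Q where "Q \<sigma> \<tau> \<longleftrightarrow> (case \<sigma> of (n, E, F) \<Rightarrow> case \<tau> of (m, G, H) \<Rightarrow>
      lin_span F E \<subseteq> lin_span H G)" for \<sigma> \<tau> :: "nat \<times> (nat \<times> nat) set \<times> (nat \<times> nat \<Rightarrow> 'a)"
  have fin: "finite (s ` {..k})" "s ` {..k} \<subseteq> A" "(1::real) / Suc k > 0" for k using s by auto
  obtain f where f: "\<And>k. P k (f k)" "\<And>k. Q (f k) (f (Suc k))"
  proof -
    have "\<exists>f. \<forall>k. P k (f k) \<and> Q (f k) (f (Suc k))"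
    proof (rule dependent_nat_choice)
      obtain n E F where "regular_units A C n E F"
        "\<forall>x\<in>s ` {..0}. \<exists>b\<in>lin_span F E. norm (x - b) < 1 / Suc 0"
        using loc fin[of 0] unfolding locally_regular_def by meson
      then have "P 0 (n, E, F)" by (simp add: P_def)
      then show "\<exists>\<sigma>. P 0 \<sigma>" by blast
    next
      fix \<sigma> k assume P: "P k \<sigma>"
      obtain n E F where \<sigma>: "\<sigma> = (n, E, F)" by (cases \<sigma>)
      have "regular_units A C n E F" using P by (simp add: P_def \<sigma>)
      then obtain m G H where "regular_units A C m G H" "lin_span F E \<subseteq> lin_span H G"
        "\<forall>x\<in>s ` {..Suc k}. \<exists>b\<in>lin_span H G. norm (x - b) < 1 / Suc (Suc k)"
        using extend_regular_units[OF loc _ fin(1,2) fin(3)] by metis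
      then have "P (Suc k) (m, G, H) \<and> Q \<sigma> (m, G, H)" by (simp add: P_def Q_def \<sigma>)
      then show "\<exists>\<tau>. P (Suc k) \<tau> \<and> Q \<sigma> \<tau>" by blast
    qed
    then show thesis using that by blast
  qed
  show thesis
  proof (rule that[of "\<lambda>k. fst (f k)" "\<lambda>k. fst (snd (f k))" "\<lambda>k. snd (snd (f k))"])
    fix k
    show "regular_units A C (fst (f k)) (fst (snd (f k))) (snd (snd (f k)))"
      using f(1)[of k] by (simp add: P_def case_prod_unfold)
    show "lin_span (snd (snd (f k))) (fst (snd (f k))) \<subseteq>
        lin_span (snd (snd (f (Suc k)))) (fst (snd (f (Suc k))))"
      using f(2)[of k] by (simp add: Q_def case_prod_unfold)
    fix j assume "j \<le> k"
    then show "\<exists>b\<in>lin_span (snd (snd (f k))) (fst (snd (f k))). norm (s j - b) < 1 / Suc k"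
      using f(1)[of k] by (simp add: P_def case_prod_unfold)
  qed
qed

text \<open>Only nesting of the spans is built into the chain. Nesting of masas and normalizers
  follows because \<open>Cs k\<close> is the intersection of \<open>C\<close> with \<open>As k\<close>, and the normalizers of \<open>Cs k\<close>
  in \<open>As k\<close> are the normalizers of \<open>C\<close> that lie in \<open>As k\<close>. Density of the masas follows from
  density of the \<open>As k\<close> by taking diagonal parts.\<close>

lemma regular_limit_of_locally_regular:
  assumes loc: locally_regular and sep: "separable_space (top_of_set A)"
  shows "regular_limit_of_digraph_algebras A C"
proof -
  have "0 \<in> A" using subalgebra_A by (simp add: complex_subalgebra_def)
  obtain U where U: "countable U" "U \<subseteq> A" "A \<subseteq> closure U"
  proof -
    obtain U where "countable U" "U \<subseteq> A" "(top_of_set A) closure_of U = A"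
      using sep unfolding separable_space_def by auto
    moreover have "A \<inter> U = U" using \<open>U \<subseteq> A\<close> by blast
    ultimately have "A \<subseteq> closure U" by (auto simp: closure_of_subtopology)
    then show thesis using that \<open>countable U\<close> \<open>U \<subseteq> A\<close> by blast
  qed
  then have "U \<noteq> {}" using \<open>0 \<in> A\<close> by auto
  define s where "s = from_nat_into U"
  have rs: "range s = U" unfolding s_def using range_from_nat_into[OF \<open>U \<noteq> {}\<close> U(1)] .
  then have "range s \<subseteq> A" using U(2) by simp
  then obtain n E F where units: "\<And>k. regular_units A C (n k) (E k) (F k)"
    and mono: "\<And>k. lin_span (F k) (E k) \<subseteq> lin_span (F (Suc k)) (E (Suc k))"
    and near: "\<And>j k. j \<le> k \<Longrightarrow> \<exists>b\<in>lin_span (F k) (E k). norm (s j - b) < 1 / Suc k"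
    using chain_of_regular_units[OF loc] by blast
  define As where "As k = lin_span (F k) (E k)" for k
  define Cs where "Cs k = lin_span (F k) (Id_on {..<n k})" for k
  have CsA: "Cs k \<subseteq> As k" "Cs k \<subseteq> C" "As k \<subseteq> A" for k
    unfolding As_def Cs_def using regular_units.diagonal_span_subset_E[OF units]
      regular_units.diagonal_span_subset_C[OF units] regular_units.span_E_subset_A[OF units] by auto
  have C_As: "x \<in> Cs k" if "x \<in> C" "x \<in> As k" for x k
    using regular_units.masa_element_diagonal[OF units that(1)] that(2)
      regular_units.span_E_subset_span_R[OF units] unfolding As_def Cs_def by blast
  have norm_iff: "v \<in> masa_normalizer (As k) (Cs k) \<longleftrightarrow> v \<in> masa_normalizer A C" if "v \<in> As k" for v k
    using regular_units.masa_normalizer_span[OF units] that unfolding As_def Cs_def by blast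
  have dense: "\<exists>k. \<exists>b\<in>As k. norm (x - b) < e" if x: "x \<in> A" and "e > 0" for x and e :: real
  proof -
    have "\<exists>y\<in>U. dist y x < e / 2" using U(3) x \<open>e > 0\<close> by (meson closure_approachable half_gt_zero subsetD)
    then obtain j where j: "norm (x - s j) < e / 2"
      using rs by (auto simp: dist_norm norm_minus_commute)
    obtain N where N: "1 / Suc N < e / 2" using \<open>e > 0\<close> by (metis half_gt_zero nat_approx_posE)
    obtain b where b: "b \<in> As (max j N)" "norm (s j - b) < 1 / Suc (max j N)"
      using near[of j "max j N"] by (auto simp: As_def)
    have "(1::real) / Suc (max j N) \<le> 1 / Suc N" by (intro divide_left_mono) auto
    then have "norm (x - b) < e"
      using norm_triangle_ineq[of "x - s j" "s j - b"] j b(2) N by simp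
    then show ?thesis using b(1) by blast
  qed
  show ?thesis
    unfolding regular_limit_of_digraph_algebras_def
  proof (rule exI[of _ As], rule exI[of _ Cs], intro conjI allI)
    fix k
    show "operator_algebra_with_masa (As k) (Cs k)"
      unfolding As_def Cs_def by (rule regular_units.operator_algebra_with_masa_span[OF units])
    show "As k \<subseteq> As (Suc k)" unfolding As_def by (rule mono)
    then show "Cs k \<subseteq> Cs (Suc k)" using CsA C_As by blast
    show "As k \<subseteq> A" "Cs k \<subseteq> C" by (rule CsA)+
    show "masa_normalizer (As k) (Cs k) \<subseteq> masa_normalizer (As (Suc k)) (Cs (Suc k))"
    proof
      fix v assume v: "v \<in> masa_normalizer (As k) (Cs k)"
      then have "v \<in> As k" by (simp add: masa_normalizer_iff)
      moreover have "v \<in> As (Suc k)" using \<open>As k \<subseteq> As (Suc k)\<close> \<open>v \<in> As k\<close> by blast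
      ultimately show "v \<in> masa_normalizer (As (Suc k)) (Cs (Suc k))" using v norm_iff by blast
    qed
    interpret regular_units A C "n k" "E k" "F k" by (rule units)
    show "\<exists>n' E' \<phi>. rt_digraph n' E' \<and> star_extendible_injection n' (digraph_algebra n' E') A \<phi> \<and>
        As k = \<phi> ` digraph_algebra n' E' \<and> Cs k = \<phi> ` diagonal_masa n'"
      using digraph realize_star_extendible realize_image[OF subset_conn]
        realize_image[OF diagonal_subset_R]
      by (intro exI[of _ "n k"] exI[of _ "E k"] exI[of _ realize]) (simp add: As_def Cs_def diagonal_masa_eq)
  next
    show "A \<subseteq> closure (\<Union>k. As k)"
    proof
      fix x assume "x \<in> A"
      then show "x \<in> closure (\<Union>k. As k)"
        unfolding closure_approachable dist_norm using dense by (metis UN_I UNIV_I norm_minus_commute)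
    qed
    show "C \<subseteq> closure (\<Union>k. Cs k)"
      unfolding closure_approachable subset_iff dist_norm
    proof (intro allI impI)
      fix c and e :: real assume c: "c \<in> C" and "e > 0"
      then obtain k b where b: "b \<in> As k" "norm (c - b) < e / 3"
        using dense[of c "e / 3"] C_subset_A by auto
      interpret regular_units A C "n k" "E k" "F k" by (rule units)
      have "b \<in> lin_span (F k) (conn (E k))" using b(1) span_E_subset_span_R by (auto simp: As_def)
      then obtain d where "d \<in> Cs k" "norm (c - d) < e"
        using masa_near_diagonal[OF c _ b(2)] by (auto simp: Cs_def)
      then show "\<exists>y\<in>\<Union>k. Cs k. norm (y - c) < e" by (metis UN_I UNIV_I norm_minus_commute)
    qed
  qed
qed

end

section \<open>Regular limits are locally regular\<close>

lemma injection_maps_normalizers: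
  fixes A :: "'a::c_star_algebra set"
  assumes E: "rt_digraph n E" and ext: "star_extendible_injection n (digraph_algebra n E) A \<phi>"
  shows "\<phi> ` mat_masa_normalizer (digraph_algebra n E) (diagonal_masa n) \<subseteq>
    masa_normalizer (\<phi> ` digraph_algebra n E) (\<phi> ` diagonal_masa n)"
proof
  let ?B = "digraph_algebra n E"
  let ?M = "mat_generated_c_star n ?B"
  have B: "?B \<subseteq> carrier_mat n n" by (auto simp: digraph_algebra_def)
  have star: "mat_star_subalgebra n ?M" and BM: "?B \<subseteq> ?M"
    using mat_star_subalgebra_generated[OF B] by auto
  have sub: "E \<subseteq> {..<n} \<times> {..<n}" "Id_on {..<n} \<subseteq> {..<n} \<times> {..<n}" "Id_on {..<n} \<subseteq> E"
    using E by (auto simp: rt_digraph_def preorder_on_def refl_on_def)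
  have CB: "diagonal_masa n \<subseteq> ?B"
    unfolding diagonal_masa_eq subset_iff digraph_algebra_iff[OF sub(1)] digraph_algebra_iff[OF sub(2)]
    using sub(3) by blast
  obtain \<psi> where hom: "star_hom ?M (generated_c_star A) \<psi>" and ext: "\<And>b. b \<in> ?B \<Longrightarrow> \<phi> b = \<psi> b"
    using ext unfolding star_extendible_injection_def by blast
  have mult: "\<psi> (X * Y) = \<psi> X * \<psi> Y" "X * Y \<in> ?M" if "X \<in> ?M" "Y \<in> ?M" for X Y
    using hom star that by (auto simp: star_hom_def mat_star_subalgebra_def)
  have adjoint: "\<psi> (mat_adjoint X) = adj (\<psi> X)" "mat_adjoint X \<in> ?M" if "X \<in> ?M" for X
    using hom star that by (auto simp: star_hom_def mat_star_subalgebra_def)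
  fix v assume "v \<in> \<phi> ` mat_masa_normalizer ?B (diagonal_masa n)"
  then obtain x where x: "x \<in> ?B" "x * mat_adjoint x * x = x"
    "\<And>c. c \<in> diagonal_masa n \<Longrightarrow> mat_adjoint x * c * x \<in> diagonal_masa n"
    "\<And>c. c \<in> diagonal_masa n \<Longrightarrow> x * c * mat_adjoint x \<in> diagonal_masa n"
    and v: "v = \<phi> x" by (auto simp: mat_masa_normalizer_def)
  have xM: "x \<in> ?M" and v: "v = \<psi> x" using x(1) BM v ext by auto
  have "v * adj v * v = v"
    using arg_cong[OF x(2), of \<psi>] mult adjoint xM by (simp add: v)
  moreover have "adj v * d * v \<in> \<phi> ` diagonal_masa n \<and> v * d * adj v \<in> \<phi> ` diagonal_masa n"
    if "d \<in> \<phi> ` diagonal_masa n" for d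
  proof -
    obtain c where c: "c \<in> diagonal_masa n" and "d = \<phi> c"
      using \<open>d \<in> \<phi> ` diagonal_masa n\<close> by blast
    then have d: "d = \<psi> c" and cM: "c \<in> ?M" using CB BM ext by auto
    have "adj v * d * v = \<psi> (mat_adjoint x * c * x)" "v * d * adj v = \<psi> (x * c * mat_adjoint x)"
      using mult adjoint xM cM by (simp_all add: v d)
    moreover have "\<psi> y \<in> \<phi> ` diagonal_masa n" if "y \<in> diagonal_masa n" for y
      using that ext CB by (metis imageI subsetD)
    ultimately show ?thesis using x(3,4)[OF c] by simp
  qed
  moreover have "v \<in> \<phi> ` ?B" using x(1) ext v by auto
  ultimately show "v \<in> masa_normalizer (\<phi> ` ?B) (\<phi> ` diagonal_masa n)"
    by (auto simp: masa_normalizer_def partial_isometry_def)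
qed

lemma normalizes_closure:
  assumes "\<And>c. c \<in> S \<Longrightarrow> adj v * c * v \<in> C \<and> v * c * adj v \<in> C" and "closed C" "C \<subseteq> closure S"
  shows "normalizes C (v::'a::c_star_algebra)"
proof -
  have "closed {c. adj v * c * v \<in> C}" "closed {c. v * c * adj v \<in> C}"
    using continuous_closed_vimage[OF assms(2), of "\<lambda>c. adj v * c * v"]
      continuous_closed_vimage[OF assms(2), of "\<lambda>c. v * c * adj v"]
    by (simp_all add: vimage_def continuous_intros)
  then have "closure S \<subseteq> {c. adj v * c * v \<in> C} \<inter> {c. v * c * adj v \<in> C}"
    using assms(1) by (intro closure_minimal closed_Int) auto
  then show ?thesis using assms(3) by (auto simp: normalizes_def)
qed

text \<open>Along the chain \<open>v\<close> normalizes every later \<open>Cs j\<close>, hence the closure \<open>C\<close> of their union.\<close>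

lemma chain_normalizer:
  fixes As Cs :: "nat \<Rightarrow> 'a::c_star_algebra set"
  assumes "closed C" "C \<subseteq> closure (\<Union>k. Cs k)" "\<And>k. Cs k \<subseteq> C" "\<And>k. Cs k \<subseteq> Cs (Suc k)" "As k \<subseteq> A"
    and chain: "\<And>k. masa_normalizer (As k) (Cs k) \<subseteq> masa_normalizer (As (Suc k)) (Cs (Suc k))"
    and v: "v \<in> masa_normalizer (As k) (Cs k)"
  shows "v \<in> masa_normalizer A C"
proof -
  have later: "v \<in> masa_normalizer (As j) (Cs j)" if "k \<le> j" for j
    using that
  proof (induction j rule: dec_induct)
    case base
    then show ?case by (rule v)
  next
    case (step j)
    then show ?case using chain[of j] by blast
  qed
  have mono: "Cs i \<subseteq> Cs j" if "i \<le> j" for i j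
    using assms(4) that by (rule lift_Suc_mono_le)
  have "normalizes C v"
  proof (rule normalizes_closure[OF _ assms(1,2)])
    fix c assume "c \<in> (\<Union>k. Cs k)"
    then obtain i where "c \<in> Cs i" by blast
    then have "c \<in> Cs (max i k)" using mono[of i "max i k"] by auto
    then show "adj v * c * v \<in> C \<and> v * c * adj v \<in> C"
      using later[of "max i k"] assms(3) by (auto simp: masa_normalizer_iff normalizes_def)
  qed
  then show ?thesis using v assms(5) by (auto simp: masa_normalizer_iff)
qed

section \<open>The characterization\<close>

theorem theorem3p11:
  fixes A C :: "'a::c_star_algebra set"
  assumes "operator_algebra_with_masa A C"
    and "separable_space (top_of_set A)"
  shows "regular_limit_of_digraph_algebras A C \<longleftrightarrow>
    (\<forall>\<epsilon>>0. \<forall>S. finite S \<and> S \<subseteq> A \<longrightarrow>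
      (\<exists>n E \<phi>. rt_digraph n E \<and>
         star_extendible_injection n (digraph_algebra n E) A \<phi> \<and>
         regular_map (digraph_algebra n E) (diagonal_masa n) A C \<phi> \<and>
         (\<forall>s\<in>S. infdist s (\<phi> ` digraph_algebra n E) < \<epsilon>)))"
    (is "_ \<longleftrightarrow> ?local")
proof
  interpret operator_masa A C by standard (rule assms(1))
  show ?local if limit: "regular_limit_of_digraph_algebras A C"
  proof (intro allI impI)
    fix \<epsilon> :: real and S assume "\<epsilon> > 0" and S: "finite S \<and> S \<subseteq> A"
    obtain As Cs :: "nat \<Rightarrow> 'a set" where
      step: "\<And>k. As k \<subseteq> As (Suc k) \<and> As k \<subseteq> A \<and> Cs k \<subseteq> Cs (Suc k) \<and> Cs k \<subseteq> C"
      and inj: "\<And>k. \<exists>n E \<phi>. rt_digraph n E \<and> star_extendible_injection n (digraph_algebra n E) A \<phi> \<and>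
        As k = \<phi> ` digraph_algebra n E \<and> Cs k = \<phi> ` diagonal_masa n"
      and chain: "\<And>k. masa_normalizer (As k) (Cs k) \<subseteq> masa_normalizer (As (Suc k)) (Cs (Suc k))"
      and dense: "A \<subseteq> closure (\<Union>k. As k)" "C \<subseteq> closure (\<Union>k. Cs k)"
      using limit unfolding regular_limit_of_digraph_algebras_def
      by (elim exE conjE) (rule that; simp)
    have "As k \<subseteq> As (Suc k)" for k using step by blast
    then have mono: "As i \<subseteq> As j" if "i \<le> j" for i j using that by (rule lift_Suc_mono_le)
    have "\<exists>k. \<exists>b\<in>As k. dist s b < \<epsilon>" if "s \<in> S" for s
    proof -
      have "s \<in> closure (\<Union>k. As k)" using dense(1) S that by blast
      then obtain b where "b \<in> (\<Union>k. As k)" "dist b s < \<epsilon>"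
        using \<open>\<epsilon> > 0\<close> unfolding closure_approachable by blast
      then show ?thesis by (auto simp: dist_commute)
    qed
    then obtain k where k: "\<And>s. s \<in> S \<Longrightarrow> \<exists>b\<in>As (k s). dist s b < \<epsilon>" by metis
    define K where "K = Max (insert 0 (k ` S))"
    have near: "\<exists>b\<in>As K. dist s b < \<epsilon>" if "s \<in> S" for s
    proof -
      have "k s \<le> K" using S that by (auto simp: K_def)
      then show ?thesis using k[OF that] mono by blast
    qed
    obtain n E \<phi> where n: "rt_digraph n E" "star_extendible_injection n (digraph_algebra n E) A \<phi>"
      "As K = \<phi> ` digraph_algebra n E" "Cs K = \<phi> ` diagonal_masa n"
      using inj by blast
    have "masa_normalizer (As K) (Cs K) \<subseteq> masa_normalizer A C"
    proof
      fix v assume "v \<in> masa_normalizer (As K) (Cs K)"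
      with closed_C dense(2) _ _ _ chain show "v \<in> masa_normalizer A C"
        by (rule chain_normalizer) (use step in blast)+
    qed
    with injection_maps_normalizers[OF n(1,2), folded n(3,4)]
    have "regular_map (digraph_algebra n E) (diagonal_masa n) A C \<phi>"
      unfolding regular_map_def by (rule order_trans)
    moreover have "infdist s (\<phi> ` digraph_algebra n E) < \<epsilon>" if "s \<in> S" for s
    proof -
      obtain b where "b \<in> \<phi> ` digraph_algebra n E" "dist s b < \<epsilon>"
        using near[OF \<open>s \<in> S\<close>] unfolding n(3) by blast
      then show ?thesis by (intro order_le_less_trans[OF infdist_le])
    qed
    ultimately show "\<exists>n E \<phi>. rt_digraph n E \<and>
         star_extendible_injection n (digraph_algebra n E) A \<phi> \<and>
         regular_map (digraph_algebra n E) (diagonal_masa n) A C \<phi> \<and>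
         (\<forall>s\<in>S. infdist s (\<phi> ` digraph_algebra n E) < \<epsilon>)"
      using n by blast
  qed
  show "regular_limit_of_digraph_algebras A C" if local_approx: ?local
  proof (rule regular_limit_of_locally_regular[OF _ assms(2)])
    show locally_regular
      unfolding locally_regular_def
    proof (intro allI impI)
      fix \<epsilon> :: real and S assume "\<epsilon> > 0" "finite S \<and> S \<subseteq> A"
      then obtain n E \<phi> where n: "rt_digraph n E"
        "star_extendible_injection n (digraph_algebra n E) A \<phi>"
        "regular_map (digraph_algebra n E) (diagonal_masa n) A C \<phi>"
        "\<forall>s\<in>S. infdist s (\<phi> ` digraph_algebra n E) < \<epsilon>"
        using local_approx by meson
      obtain F where F: "regular_units A C n E F" "\<phi> ` digraph_algebra n E = lin_span F E"
        using regular_units_of_injection[OF operator_masa_axioms n(1-3)] by blast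
      have "\<exists>b\<in>lin_span F E. norm (s - b) < \<epsilon>" if "s \<in> S" for s
      proof -
        have ne: "lin_span F E \<noteq> {}" using lin_span_zero[of F E] by blast
        have "infdist s (lin_span F E) < \<epsilon>" using n(4) that unfolding F(2) by blast
        then have "(INF b\<in>lin_span F E. dist s b) < \<epsilon>" by (simp add: infdist_notempty[OF ne])
        then obtain y where "y \<in> dist s ` lin_span F E" "y < \<epsilon>"
          using cInf_lessD[of "dist s ` lin_span F E" \<epsilon>] ne by blast
        then show ?thesis by (auto simp: dist_norm)
      qed
      then show "\<exists>n E F. regular_units A C n E F \<and> (\<forall>s\<in>S. \<exists>b\<in>lin_span F E. norm (s - b) < \<epsilon>)"
        using F(1) by blast
    qed
  qed
qed

end
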